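(* A function $f(q)=\sum_{k=0}^\infty q^kc_k$ with $c_k\in\mathbb{H}$ belongs to $\mathcal{SF}(\mathbb{H})$ if and only if $$\sup_{k\in\mathbb{N}}|c_k|\,k^p\sqrt{k!}<\infty\quad\text{for all }p>0.$$ That is, $$\mathcal{SF}(\mathbb{H})=\Big\{\sum_{k=0}^\infty q^kc_k:\ c_k\in\mathbb{H}\ \text{ and }\ \sup_{k\in\mathbb{N}}|c_k|\,k^p\sqrt{k!}<\infty\ \ \forall p>0\Big\}.$$
   Context: $\mathbb{H}$ is the algebra of real quaternions. The quaternionic Schwartz space on the real line is the space $\mathcal{S}_{\mathbb{H}}(\mathbb{R})$ of (smooth) functions $\psi:\mathbb{R}\to\mathbb{H}$ such that $\sup_{x\in\mathbb{R}}\left|x^\alpha\frac{d^\beta}{dx^\beta}\psi(x)\right|<\infty$ for all $\alpha,\beta\in\mathbb{N}$ (with $0\in\mathbb{N}$). The quaternionic Segal-Bargmann transform (with parameter $\nu=1$) is $$\mathcal{B}^S_{\mathbb{H}}(\varphi)(q)=\int_{\mathbb{R}}\mathcal{A}^S_{\mathbb{H}}(q,x)\varphi(x)\,dx,\qquad \mathcal{A}^S_{\mathbb{H}}(q,x)=\pi^{-3/4}e^{-\frac12(q^2+x^2)+\sqrt2\,qx},\quad q\in\mathbb{H},\ x\in\mathbb{R}.$$ $\mathcal{SF}(\mathbb{H})$ denotes the range of $\mathcal{S}_{\mathbb{H}}(\mathbb{R})$ under this transform, i.e. $\mathcal{SF}(\mathbb{H})=\{\mathcal{B}^S_{\mathbb{H}}(\psi):\psi\in\mathcal{S}_{\mathbb{H}}(\mathbb{R})\}$.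 *)

theory Defs
  imports "HOL-Analysis.Analysis"
begin

section \<open>The algebra of real quaternions\<close>

datatype quat = Quat (qre: real) (qi: real) (qj: real) (qk: real)

lemma quat_eq_iff: "p = q \<longleftrightarrow> qre p = qre q \<and> qi p = qi q \<and> qj p = qj q \<and> qk p = qk q"
  by (cases p; cases q) simp

instantiation quat :: ab_group_add
begin

definition "0 = Quat 0 0 0 0"
definition "p + q = Quat (qre p + qre q) (qi p + qi q) (qj p + qj q) (qk p + qk q)"
definition "- p = Quat (- qre p) (- qi p) (- qj p) (- qk p)"
definition "p - q = Quat (qre p - qre q) (qi p - qi q) (qj p - qj q) (qk p - qk q)"

instance
  by standard
    (simp_all add: quat_eq_iff zero_quat_def plus_quat_def uminus_quat_def minus_quat_def)

end

lemma quat_add_sel [simp]: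
  "qre 0 = 0" "qi 0 = 0" "qj 0 = 0" "qk 0 = 0"
  "qre (p + q) = qre p + qre q" "qi (p + q) = qi p + qi q"
  "qj (p + q) = qj p + qj q" "qk (p + q) = qk p + qk q"
  "qre (- p) = - qre p" "qi (- p) = - qi p" "qj (- p) = - qj p" "qk (- p) = - qk p"
  "qre (p - q) = qre p - qre q" "qi (p - q) = qi p - qi q"
  "qj (p - q) = qj p - qj q" "qk (p - q) = qk p - qk q"
  by (simp_all add: zero_quat_def plus_quat_def uminus_quat_def minus_quat_def)

instantiation quat :: real_vector
begin

definition "r *\<^sub>R q = Quat (r * qre q) (r * qi q) (r * qj q) (r * qk q)"

instance
  by standard (simp_all add: quat_eq_iff scaleR_quat_def algebra_simps)

end

lemma quat_scaleR_sel [simp]: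
  "qre (r *\<^sub>R q) = r * qre q" "qi (r *\<^sub>R q) = r * qi q"
  "qj (r *\<^sub>R q) = r * qj q" "qk (r *\<^sub>R q) = r * qk q"
  by (simp_all add: scaleR_quat_def)

text \<open>Hamilton's product, with i j = k, j k = i, k i = j.\<close>

instantiation quat :: real_algebra_1
begin

definition "1 = Quat 1 0 0 0"
definition "p * q = Quat
  (qre p * qre q - qi p * qi q - qj p * qj q - qk p * qk q)
  (qre p * qi q + qi p * qre q + qj p * qk q - qk p * qj q)
  (qre p * qj q - qi p * qk q + qj p * qre q + qk p * qi q)
  (qre p * qk q + qi p * qj q - qj p * qi q + qk p * qre q)"

instance
  by standard
    (simp_all add: quat_eq_iff one_quat_def times_quat_def algebra_simps)

end

lemma quat_mult_sel [simp]:
  "qre 1 = 1" "qi 1 = 0" "qj 1 = 0" "qk 1 = 0"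
  "qre (p * q) = qre p * qre q - qi p * qi q - qj p * qj q - qk p * qk q"
  "qi (p * q) = qre p * qi q + qi p * qre q + qj p * qk q - qk p * qj q"
  "qj (p * q) = qre p * qj q - qi p * qk q + qj p * qre q + qk p * qi q"
  "qk (p * q) = qre p * qk q + qi p * qj q - qj p * qi q + qk p * qre q"
  by (simp_all add: one_quat_def times_quat_def)

lemma quat_of_real_sel [simp]:
  "qre (of_real r) = r" "qi (of_real r) = 0" "qj (of_real r) = 0" "qk (of_real r) = 0"
  by (simp_all add: of_real_def)

lemma quat_norm_sq_pos:
  assumes "q \<noteq> 0"
  shows "(qre q)\<^sup>2 + (qi q)\<^sup>2 + (qj q)\<^sup>2 + (qk q)\<^sup>2 > 0"
proof -
  have "qre q \<noteq> 0 \<or> qi q \<noteq> 0 \<or> qj q \<noteq> 0 \<or> qk q \<noteq> 0"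
    using assms by (auto simp: quat_eq_iff)
  then show ?thesis
    by (smt (verit) zero_le_power2 zero_less_power2)
qed

instantiation quat :: real_div_algebra
begin

definition "inverse q =
  (1 / ((qre q)\<^sup>2 + (qi q)\<^sup>2 + (qj q)\<^sup>2 + (qk q)\<^sup>2)) *\<^sub>R
    Quat (qre q) (- qi q) (- qj q) (- qk q)"
definition "p div (q :: quat) = p * inverse q"

instance
proof
  fix p q :: quat
  show "inverse (0 :: quat) = 0"
    by (simp add: inverse_quat_def quat_eq_iff)
  show "p div q = p * inverse q"
    by (rule divide_quat_def)
  assume "q \<noteq> 0"
  define n where "n = (qre q)\<^sup>2 + (qi q)\<^sup>2 + (qj q)\<^sup>2 + (qk q)\<^sup>2"
  have "n \<noteq> 0"
    using quat_norm_sq_pos[OF \<open>q \<noteq> 0\<close>] by (simp add: n_def)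
  have "Quat (qre q) (- qi q) (- qj q) (- qk q) * q = n *\<^sub>R 1"
    "q * Quat (qre q) (- qi q) (- qj q) (- qk q) = n *\<^sub>R 1"
    by (simp_all add: quat_eq_iff n_def power2_eq_square)
  then show "inverse q * q = 1" "q * inverse q = 1"
    using \<open>n \<noteq> 0\<close> by (simp_all add: inverse_quat_def flip: n_def)
qed

end

instantiation quat :: real_inner
begin

definition "inner p q = qre p * qre q + qi p * qi q + qj p * qj q + qk p * qk q"
definition "norm q = sqrt ((qre q)\<^sup>2 + (qi q)\<^sup>2 + (qj q)\<^sup>2 + (qk q)\<^sup>2)"
definition "sgn q = inverse (norm q) *\<^sub>R (q :: quat)"
definition "dist p q = norm (p - q :: quat)"
definition [code del]:
  "(uniformity :: (quat \<times> quat) filter) = (INF e\<in>{0<..}. principal {(x, y). dist x y < e})"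
definition [code del]:
  "open (U :: quat set) \<longleftrightarrow> (\<forall>x\<in>U. eventually (\<lambda>(x', y). x' = x \<longrightarrow> y \<in> U) uniformity)"

instance
proof
  fix p q s :: quat and r :: real and U :: "quat set"
  show "dist p q = norm (p - q)" by (rule dist_quat_def)
  show "sgn q = q /\<^sub>R norm q" by (rule sgn_quat_def)
  show "(uniformity :: (quat \<times> quat) filter) =
      (INF e\<in>{0<..}. principal {(x, y). dist x y < e})"
    by (rule uniformity_quat_def)
  show "open U \<longleftrightarrow> (\<forall>x\<in>U. eventually (\<lambda>(x', y). x' = x \<longrightarrow> y \<in> U) uniformity)"
    by (rule open_quat_def)
  show "inner p q = inner q p" by (simp add: inner_quat_def algebra_simps)
  show "inner (p + q) s = inner p s + inner q s" by (simp add: inner_quat_def algebra_simps)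
  show "inner (r *\<^sub>R p) q = r * inner p q" by (simp add: inner_quat_def algebra_simps)
  show "0 \<le> inner p p" by (simp add: inner_quat_def)
  show "inner p p = 0 \<longleftrightarrow> p = 0"
    using quat_norm_sq_pos[of p]
    by (cases "p = 0") (auto simp: inner_quat_def power2_eq_square)
  show "norm p = sqrt (inner p p)"
    by (simp add: norm_quat_def inner_quat_def power2_eq_square)
qed

end

instance quat :: real_normed_div_algebra
proof
  fix p q :: quat
  show "norm (p * q) = norm p * norm q"
    unfolding norm_quat_def real_sqrt_mult[symmetric]
    by (rule arg_cong[where f = sqrt], simp only: quat_mult_sel, algebra)
qed

instantiation quat :: euclidean_space
begin

definition "Basis = {Quat 1 0 0 0, Quat 0 1 0 0, Quat 0 0 1 0, Quat 0 0 0 1}"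

instance
proof
  show "(Basis :: quat set) \<noteq> {}" "finite (Basis :: quat set)"
    by (simp_all add: Basis_quat_def)
  show "inner u v = (if u = v then 1 else 0)" if "u \<in> Basis" "v \<in> Basis" for u v :: quat
    using that unfolding Basis_quat_def
    by (elim insertE emptyE) (simp_all add: inner_quat_def)
  show "(\<forall>u\<in>Basis. inner x u = 0) \<longleftrightarrow> x = 0" for x :: quat
    by (simp add: Basis_quat_def inner_quat_def quat_eq_iff[of x 0])
qed

end


section \<open>The quaternionic Schwartz space\<close>

definition iter_deriv :: "nat \<Rightarrow> (real \<Rightarrow> quat) \<Rightarrow> real \<Rightarrow> quat" where
  "iter_deriv n = (\<lambda>f x. vector_derivative f (at x)) ^^ n"

text \<open>\<open>vector_derivative\<close> is total, hence smoothness is required separately.\<close>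

definition schwartz_quat :: "(real \<Rightarrow> quat) set" where
  "schwartz_quat = {\<psi>. (\<forall>n x. iter_deriv n \<psi> differentiable (at x)) \<and>
     (\<forall>\<alpha> \<beta>. bdd_above (range (\<lambda>x. norm (x ^ \<alpha> *\<^sub>R iter_deriv \<beta> \<psi> x))))}"


section \<open>The quaternionic Segal--Bargmann transform\<close>

definition SB_kernel :: "quat \<Rightarrow> real \<Rightarrow> quat" where
  "SB_kernel q x = (pi powr (-3/4)) *\<^sub>R
     exp (- ((1/2) *\<^sub>R (q\<^sup>2 + of_real (x\<^sup>2))) + sqrt 2 *\<^sub>R (q * of_real x))"

definition SB_transform :: "(real \<Rightarrow> quat) \<Rightarrow> quat \<Rightarrow> quat" where
  "SB_transform \<phi> q = (\<integral>x. SB_kernel q x * \<phi> x \<partial>lborel)"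

definition SF :: "(quat \<Rightarrow> quat) set" where
  "SF = SB_transform ` schwartz_quat"

end

theory Submission
  imports Defs "HOL-Probability.Sinc_Integral"
begin

text \<open>
  Let \<open>h\<^sub>k\<close> be the orthonormal Hermite functions. The generating function of the Hermite polynomials
  gives \<open>SB_kernel q x = \<Sum>k. (\<pi>\<^sup>-\<^sup>1\<^sup>/\<^sup>2 h\<^sub>k x / \<surd>k!) q\<^sup>k\<close>, so the transform of \<open>\<phi>\<close> is the power series with
  coefficients \<open>c\<^sub>k = \<pi>\<^sup>-\<^sup>1\<^sup>/\<^sup>2 a\<^sub>k / \<surd>k!\<close>, where \<open>a\<^sub>k = \<integral> h\<^sub>k \<phi>\<close>, and the growth condition says
  that \<open>a\<close> decreases rapidly. For Schwartz \<open>\<phi>\<close>, integration by parts with the ladder relation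
  \<open>x h\<^sub>k - h\<^sub>k' = \<surd>(2(k+1)) h\<^sub>k\<^sub>+\<^sub>1\<close> gains a factor \<open>k\<^sup>-\<^sup>1\<^sup>/\<^sup>2\<close> each time. Conversely the functions
  \<open>\<Sum>k. h\<^sub>k a\<^sub>k\<close> with rapidly decreasing \<open>a\<close> are bounded, since \<open>\<bar>h\<^sub>k\<bar> \<le> k + 2\<close>, and are closed under
  differentiation and multiplication by \<open>x\<close>, hence are Schwartz.
\<close>

section \<open>Rapidly decaying functions and Hermite functions\<close>

definition rapid_fun :: "(real \<Rightarrow> 'a::real_normed_vector) \<Rightarrow> bool" where
  "rapid_fun f \<longleftrightarrow> (\<forall>m::nat. \<exists>C. \<forall>x. \<bar>x\<bar> ^ m * norm (f x) \<le> C)"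

lemma rapid_funE:
  assumes "rapid_fun f"
  obtains C where "C \<ge> 0" "\<And>x. \<bar>x\<bar> ^ m * norm (f x) \<le> C"
proof -
  obtain C where C: "\<And>x. \<bar>x\<bar> ^ m * norm (f x) \<le> C"
    using assms unfolding rapid_fun_def by blast
  have "C \<ge> 0" using C[of 0] by (smt (verit) norm_ge_zero zero_le_mult_iff zero_le_power abs_ge_zero)
  with C that show ?thesis by blast
qed

lemma rapid_fun_add:
  assumes "rapid_fun f" "rapid_fun g"
  shows "rapid_fun (\<lambda>x. f x + g x)"
  unfolding rapid_fun_def
proof
  fix m
  obtain C where C: "\<And>x. \<bar>x\<bar> ^ m * norm (f x) \<le> C" using rapid_funE[OF assms(1)] by blast
  obtain D where D: "\<And>x. \<bar>x\<bar> ^ m * norm (g x) \<le> D" using rapid_funE[OF assms(2)] by blast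
  have "\<bar>x\<bar> ^ m * norm (f x + g x) \<le> C + D" for x
  proof -
    have "\<bar>x\<bar> ^ m * norm (f x + g x) \<le> \<bar>x\<bar> ^ m * (norm (f x) + norm (g x))"
      by (intro mult_left_mono norm_triangle_ineq) simp
    also have "\<dots> \<le> C + D" using C[of x] D[of x] by (simp add: algebra_simps)
    finally show ?thesis .
  qed
  then show "\<exists>C. \<forall>x. \<bar>x\<bar> ^ m * norm (f x + g x) \<le> C" by blast
qed

lemma rapid_fun_cscale:
  assumes "rapid_fun f"
  shows "rapid_fun (\<lambda>x. c *\<^sub>R f x)"
  unfolding rapid_fun_def
proof
  fix m
  obtain C where C: "\<And>x. \<bar>x\<bar> ^ m * norm (f x) \<le> C" using rapid_funE[OF assms(1)] by blast
  have "\<bar>x\<bar> ^ m * norm (c *\<^sub>R f x) \<le> \<bar>c\<bar> * C" for x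
    using mult_left_mono[OF C[of x], of "\<bar>c\<bar>"] by (simp add: ac_simps)
  then show "\<exists>C. \<forall>x. \<bar>x\<bar> ^ m * norm (c *\<^sub>R f x) \<le> C" by blast
qed

lemma rapid_fun_xscale:
  assumes "rapid_fun f"
  shows "rapid_fun (\<lambda>x. x *\<^sub>R f x)"
  unfolding rapid_fun_def
proof
  fix m
  obtain C where C: "\<And>x. \<bar>x\<bar> ^ Suc m * norm (f x) \<le> C" using rapid_funE[OF assms(1)] by blast
  then show "\<exists>C. \<forall>x. \<bar>x\<bar> ^ m * norm (x *\<^sub>R f x) \<le> C" by (auto simp: ac_simps)
qed

lemma rapid_fun_scaleR:
  assumes "rapid_fun u" "rapid_fun f"
  shows "rapid_fun (\<lambda>x. u x *\<^sub>R f x)"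
  unfolding rapid_fun_def
proof
  fix m
  obtain C where C: "\<And>x. \<bar>x\<bar> ^ m * norm (f x) \<le> C" "C \<ge> 0" using rapid_funE[OF assms(2)] by blast
  obtain D where D: "\<And>x. \<bar>x\<bar> ^ 0 * norm (u x) \<le> D" "D \<ge> 0" using rapid_funE[OF assms(1)] by blast
  have "\<bar>x\<bar> ^ m * norm (u x *\<^sub>R f x) \<le> D * C" for x
    using mult_mono[OF D(1) C(1), of x x] D(2) by (simp add: ac_simps)
  then show "\<exists>C. \<forall>x. \<bar>x\<bar> ^ m * norm (u x *\<^sub>R f x) \<le> C" by blast
qed

text \<open>The exponents 0 and 2 together bound \<open>norm (f x)\<close> by a constant multiple of
  the integrable function \<open>inverse (1 + x\<^sup>2)\<close>.\<close>

lemma rapid_fun_integrable: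
  fixes f :: "real \<Rightarrow> 'a::euclidean_space"
  assumes "rapid_fun f" "continuous_on UNIV f"
  shows "integrable lborel f"
proof -
  obtain C where C: "\<And>x. \<bar>x\<bar> ^ 0 * norm (f x) \<le> C" using rapid_funE[OF assms(1)] by blast
  obtain D where D: "\<And>x. \<bar>x\<bar> ^ 2 * norm (f x) \<le> D" using rapid_funE[OF assms(1)] by blast
  have b: "norm (f x) \<le> norm ((C + D) * inverse (1 + x\<^sup>2))" for x
  proof -
    have "(1 + x\<^sup>2) * norm (f x) \<le> C + D" using C[of x] D[of x] by (simp add: algebra_simps)
    moreover have p: "1 + x\<^sup>2 > 0" by (simp add: add_pos_nonneg)
    ultimately have "norm (f x) \<le> (C + D) * inverse (1 + x\<^sup>2)"
      by (simp add: field_simps)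
    then show ?thesis by (smt (verit) real_norm_def)
  qed
  have "integrable lborel (\<lambda>x::real. inverse (1 + x\<^sup>2))"
    using integrable_inverse_1_plus_square by (simp add: set_integrable_def)
  then have i: "integrable lborel (\<lambda>x::real. (C + D) * inverse (1 + x\<^sup>2))" by simp
  show ?thesis
    by (rule Bochner_Integration.integrable_bound[OF i])
      (use b borel_measurable_continuous_onI[OF assms(2)] in auto)
qed

lemma rapid_fun_tendsto_0:
  assumes "rapid_fun f"
  shows "(f \<longlongrightarrow> 0) at_infinity"
proof -
  obtain C where C: "\<And>x. \<bar>x\<bar> ^ 1 * norm (f x) \<le> C" using rapid_funE[OF assms(1)] by blast
  have "((\<lambda>x. norm (inverse x)) \<longlongrightarrow> norm (0::real)) (at_infinity :: real filter)"
    by (intro tendsto_norm tendsto_inverse_0)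
  then have "((\<lambda>x. C * norm (inverse x)) \<longlongrightarrow> 0) (at_infinity :: real filter)"
    by (intro tendsto_mult_right_zero) simp
  moreover have "\<forall>\<^sub>F x in at_infinity. norm (f x) \<le> C * norm (inverse x)"
    unfolding eventually_at_infinity
  proof (intro exI allI impI)
    fix x :: real assume "1 \<le> norm x"
    then show "norm (f x) \<le> C * norm (inverse x)" using C[of x] by (simp add: field_simps abs_inverse)
  qed
  ultimately show ?thesis by (rule Lim_null_comparison[rotated])
qed

text \<open>The fundamental theorem of calculus over the whole line, both boundary values being zero
  because \<open>F\<close> decays. Applied to a product, this is integration by parts without
  boundary terms.\<close>

lemma integral_derivative_eq_0:
  fixes F :: "real \<Rightarrow> 'a::euclidean_space"
  assumes F: "\<And>x. (F has_vector_derivative f x) (at x)" "rapid_fun F"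
    and f: "continuous_on UNIV f" "rapid_fun f"
  shows "integral\<^sup>L lborel f = 0"
proof -
  have "(LBINT x=-\<infinity>..\<infinity>. f x) = 0 - 0"
  proof (rule interval_integral_FTC_integrable)
    show "(F has_vector_derivative f x) (at x)" for x by (rule F)
    show "isCont f x" for x using f(1) by (simp add: continuous_on_eq_continuous_at)
    show "set_integrable lborel (einterval (-\<infinity>) \<infinity>) f"
      using rapid_fun_integrable[OF f(2,1)] by (simp add: set_integrable_def)
    show "((F \<circ> real_of_ereal) \<longlongrightarrow> 0) (at_right (-\<infinity>))" "((F \<circ> real_of_ereal) \<longlongrightarrow> 0) (at_left \<infinity>)"
      unfolding ereal_tendsto_simps
      using rapid_fun_tendsto_0[OF F(2)] by (auto intro: tendsto_mono[rotated] simp: at_top_le_at_infinity at_bot_le_at_infinity)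
  qed simp
  then show ?thesis by (simp add: interval_lebesgue_integral_def set_lebesgue_integral_def)
qed

text \<open>At \<open>k = 0\<close> the truncated index \<open>k - 1\<close> is harmless, here and below: its coefficient vanishes.\<close>

fun herm :: "nat \<Rightarrow> real \<Rightarrow> real" where
  "herm 0 x = pi powr (-1/4) * exp (- x\<^sup>2 / 2)"
| "herm (Suc k) x = (sqrt 2 * x * herm k x - sqrt (real k) * herm (k - 1) x) / sqrt (real (Suc k))"

declare herm.simps(2) [simp del]

lemma herm_rec:
  "sqrt 2 * x * herm k x = sqrt (real (Suc k)) * herm (Suc k) x + sqrt (real k) * herm (k - 1) x"
  by (simp add: herm.simps(2))

section \<open>Derivatives and decay of the Hermite functions\<close>

text \<open>Strong induction: differentiating the three-term recurrence brings in the derivatives at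
  \<open>j\<close> and \<open>j - 1\<close>, both known, and the recurrence one index lower removes
  \<open>herm (j - 1 - 1)\<close>.\<close>

lemma DERIV_herm:
  "(herm k has_real_derivative sqrt (2 * real k) * herm (k - 1) x - x * herm k x) (at x)"
proof (induction k arbitrary: x rule: less_induct)
  case (less k)
  show ?case
  proof (cases k)
    case 0
    have "((\<lambda>x. pi powr (-1/4) * exp (- x\<^sup>2 / 2)) has_real_derivative
        - x * (pi powr (-1/4) * exp (- x\<^sup>2 / 2))) (at x)"
      by (auto intro!: derivative_eq_intros)
    moreover have "herm 0 = (\<lambda>x. pi powr (-1/4) * exp (- x\<^sup>2 / 2))" by auto
    ultimately show ?thesis using 0 by simp
  next
    case (Suc j)
    have e: "herm (Suc j) = (\<lambda>x. (sqrt 2 * x * herm j x - sqrt (real j) * herm (j - 1) x) / sqrt (real (Suc j)))"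
      by (auto simp: herm.simps(2))
    define h1 where "h1 = sqrt (2 * real j) * herm (j - 1) x - x * herm j x"
    define h2 where "h2 = sqrt (2 * real (j - 1)) * herm (j - 1 - 1) x - x * herm (j - 1) x"
    have d1: "(herm j has_real_derivative h1) (at x)" using less[of j] Suc by (simp add: h1_def)
    have d2: "(herm (j-1) has_real_derivative h2) (at x)" using less[of "j-1"] Suc by (simp add: h2_def)
    have "(herm (Suc j) has_real_derivative
        (sqrt 2 * herm j x + sqrt 2 * x * h1 - sqrt (real j) * h2) / sqrt (real (Suc j))) (at x)"
      unfolding e
      by (rule DERIV_cong[OF DERIV_cdivide[OF DERIV_diff[OF DERIV_mult[OF DERIV_cmult_Id d1] DERIV_cmult[OF d2]]]])
        (simp only: mult.commute[of h1])
    \<comment> \<open>The recurrence for \<open>herm j\<close>, multiplied by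
      \<open>sqrt (real j)\<close>; for \<open>j = 0\<close> both sides vanish.\<close>
    moreover have "sqrt (real j) * (sqrt 2 * x * herm (j - 1) x - sqrt (real (j - 1)) * herm (j - 1 - 1) x) = real j * herm j x"
    proof (cases j)
      case (Suc i)
      then show ?thesis using herm_rec[of x i] by (simp del: of_nat_Suc)
    qed simp
    moreover have "sqrt (real (Suc j)) * sqrt (2 * real (Suc j)) = sqrt 2 * real (Suc j)"
      by (simp add: real_sqrt_mult del: of_nat_Suc)
    moreover have "sqrt 2 * x * (sqrt 2 * y) = 2 * x * y" for y by simp
    ultimately have "(herm (Suc j) has_real_derivative sqrt (2 * real (Suc j)) * herm j x - x * herm (Suc j) x) (at x)"
    proof -
      have "sqrt 2 * herm j x + sqrt 2 * x * h1 - sqrt (real j) * h2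
        = sqrt 2 * herm j x + sqrt 2 * (sqrt (real j) * (sqrt 2 * x * herm (j - 1) x - sqrt (real (j - 1)) * herm (j - 1 - 1) x))
          - x * (sqrt 2 * x * herm j x - sqrt (real j) * herm (j - 1) x)"
        by (simp add: h1_def h2_def real_sqrt_mult algebra_simps)
      also have "\<dots> = sqrt 2 * herm j x + sqrt 2 * (real j * herm j x) - x * (sqrt (real (Suc j)) * herm (Suc j) x)"
        using herm_rec[of x j] \<open>sqrt (real j) * _ = _\<close> by simp
      also have "\<dots> = sqrt (real (Suc j)) * (sqrt (2 * real (Suc j)) * herm j x - x * herm (Suc j) x)"
        using \<open>sqrt (real (Suc j)) * sqrt (2 * real (Suc j)) = _\<close>
        by (simp add: algebra_simps)
      finally have "(sqrt 2 * herm j x + sqrt 2 * x * h1 - sqrt (real j) * h2) / sqrt (real (Suc j))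
         = sqrt (2 * real (Suc j)) * herm j x - x * herm (Suc j) x"
        by (simp del: of_nat_Suc)
      then show ?thesis using \<open>(herm (Suc j) has_real_derivative _) (at x)\<close> by simp
    qed
    then show ?thesis using Suc by simp
  qed
qed

lemma continuous_on_herm [continuous_intros]: "continuous_on S (herm k)"
  by (meson DERIV_herm DERIV_isCont continuous_at_imp_continuous_on)

text \<open>Eliminating \<open>x * herm k x\<close> by the recurrence leaves only neighbouring
  Hermite functions with scalar coefficients. In this form differentiation of a Hermite series
  becomes an operation on its coefficients.\<close>

lemma DERIV_herm_ladder:
  "(herm k has_real_derivative sqrt (real k / 2) * herm (k - 1) x - sqrt (real (Suc k) / 2) * herm (Suc k) x) (at x)"
proof -
  have "sqrt (2 * real k) * herm (k - 1) x - x * herm k x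
    = sqrt (real k / 2) * herm (k - 1) x - sqrt (real (Suc k) / 2) * herm (Suc k) x"
  proof -
    have "x * herm k x = (sqrt (real (Suc k)) * herm (Suc k) x + sqrt (real k) * herm (k - 1) x) / sqrt 2"
      using herm_rec[of x k] by (simp add: field_simps)
    moreover have "sqrt (2 * real k) = 2 * sqrt (real k) / sqrt 2"
      using real_div_sqrt[of 2] by (simp add: real_sqrt_mult flip: times_divide_eq_left)
    ultimately show ?thesis
      by (simp add: real_sqrt_divide field_simps del: of_nat_Suc)
  qed
  then show ?thesis using DERIV_herm[of k x] by simp
qed

lemma rapid_fun_herm: "rapid_fun (herm k)"
proof (induction k rule: less_induct)
  case (less k)
  show ?case
  proof (cases k)
    case 0
    have b: "\<exists>C. \<forall>x::real. \<bar>x\<bar> ^ m * exp (- x\<^sup>2 / 2) \<le> C" for m :: nat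
    proof -
      have "\<bar>x\<bar> ^ m * exp (- x\<^sup>2 / 2) \<le> 1 + 2 ^ m * fact m" for x :: real
      proof (cases "\<bar>x\<bar> \<le> 1")
        case True
        then have "\<bar>x\<bar> ^ m * exp (- x\<^sup>2 / 2) \<le> 1 * 1" by (intro mult_mono power_le_one) auto
        then show ?thesis by (simp add: add_increasing2)
      next
        case False
        \<comment> \<open>The exponential series at \<open>x\<^sup>2/2\<close> dominates its term of
          index \<open>m\<close>. As that term has degree \<open>2 * m\<close> in \<open>x\<close>,
          the power \<open>\<bar>x\<bar> ^ m\<close> is first raised to
          \<open>\<bar>x\<bar> ^ (2 * m)\<close>, which needs
          \<open>\<bar>x\<bar> > 1\<close>.\<close>
        have "(\<Sum>n\<in>{m}. inverse (fact n) * (x\<^sup>2/2) ^ n) \<le> (\<Sum>n. inverse (fact n) * (x\<^sup>2/2) ^ n)"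
          by (intro sum_le_suminf summable_exp) auto
        then have e: "(x\<^sup>2/2) ^ m \<le> fact m * exp (x\<^sup>2/2)"
          by (simp add: exp_def field_simps)
        have "\<bar>x\<bar> ^ m \<le> \<bar>x\<bar> ^ (2 * m)" using False by (intro power_increasing) auto
        also have "\<dots> = 2 ^ m * (x\<^sup>2/2) ^ m" by (simp add: power_mult power_divide)
        also have "\<dots> \<le> 2 ^ m * (fact m * exp (x\<^sup>2/2))" using e by simp
        finally have "\<bar>x\<bar> ^ m * exp (- x\<^sup>2/2) \<le> 2 ^ m * fact m * exp (x\<^sup>2/2) * exp (- x\<^sup>2/2)"
          by (simp add: ac_simps)
        also have "\<dots> = 2 ^ m * fact m" by (simp flip: exp_add)
        finally show ?thesis by simp
      qed
      then show ?thesis by blast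
    qed
    have "rapid_fun (\<lambda>x::real. exp (- x\<^sup>2 / 2))"
      unfolding rapid_fun_def using b by simp
    from rapid_fun_cscale[OF this, of "pi powr (-1/4)"] show ?thesis using 0 by (simp add: herm.simps(1)[abs_def])
  next
    case (Suc j)
    have "rapid_fun (\<lambda>x. (1 / sqrt (real (Suc j))) *\<^sub>R (sqrt 2 *\<^sub>R (x *\<^sub>R herm j x) + (- sqrt (real j)) *\<^sub>R herm (j - 1) x))"
      using Suc by (intro rapid_fun_cscale rapid_fun_add rapid_fun_xscale less) auto
    moreover have "herm (Suc j) = (\<lambda>x. (1 / sqrt (real (Suc j))) *\<^sub>R (sqrt 2 *\<^sub>R (x *\<^sub>R herm j x) + (- sqrt (real j)) *\<^sub>R herm (j - 1) x))"
      by (auto simp: herm.simps(2))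
    ultimately show ?thesis using Suc by simp
  qed
qed

section \<open>Hermite coefficients\<close>

text \<open>The codomain is kept general: real values serve for orthonormality, quaternion values
  for Schwartz functions.\<close>

definition herm_coeff :: "(real \<Rightarrow> 'a::euclidean_space) \<Rightarrow> nat \<Rightarrow> 'a" where
  "herm_coeff \<phi> k = (\<integral>x. herm k x *\<^sub>R \<phi> x \<partial>lborel)"

lemma integrable_herm_scaleR:
  fixes \<phi> :: "real \<Rightarrow> 'a::euclidean_space"
  assumes "rapid_fun \<phi>" "continuous_on UNIV \<phi>"
  shows "integrable lborel (\<lambda>x. herm k x *\<^sub>R \<phi> x)"
  by (intro rapid_fun_integrable rapid_fun_scaleR rapid_fun_herm continuous_intros assms)

text \<open>Integration by parts: \<open>x + d/dx\<close> is the adjoint of \<open>x - d/dx\<close>,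
  which sends \<open>herm k\<close> to \<open>sqrt (2 * real (Suc k))\<close> times
  \<open>herm (Suc k)\<close>. Concretely, the derivative of
  \<open>herm k x *\<^sub>R \<phi> x\<close> integrates to zero.\<close>

lemma herm_coeff_Suc:
  fixes \<phi> :: "real \<Rightarrow> 'a::euclidean_space"
  assumes \<phi>: "\<And>x. (\<phi> has_vector_derivative \<phi>' x) (at x)" "rapid_fun \<phi>"
    and \<phi>': "continuous_on UNIV \<phi>'" "rapid_fun \<phi>'"
  shows "sqrt (2 * real (Suc k)) *\<^sub>R herm_coeff \<phi> (Suc k) = herm_coeff (\<lambda>x. x *\<^sub>R \<phi> x + \<phi>' x) k"
proof -
  have c: "continuous_on UNIV \<phi>"
    by (rule continuous_at_imp_continuous_on) (use \<phi>(1) has_vector_derivative_continuous in blast)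
  let ?g = "\<lambda>x. x *\<^sub>R \<phi> x + \<phi>' x"
  let ?f = "\<lambda>x. herm k x *\<^sub>R ?g x + (- sqrt (2 * real (Suc k))) *\<^sub>R (herm (Suc k) x *\<^sub>R \<phi> x)"
  have g: "rapid_fun ?g" "continuous_on UNIV ?g"
    by (intro rapid_fun_add rapid_fun_xscale \<phi> \<phi>') (intro continuous_intros c \<phi>')
  \<comment> \<open>With abstract scalars, the recurrence is all that is needed to rewrite the
    product-rule derivative as \<open>?f\<close>.\<close>
  have aux: "h *\<^sub>R v' + (s - x * h) *\<^sub>R v = h *\<^sub>R (x *\<^sub>R v + v') + (- c) *\<^sub>R (g *\<^sub>R v)"
    if "c * g = 2 * x * h - s" for c g h s x :: real and v v' :: 'a
  proof -
    have "s - x * h = h * x - c * g" using that by simp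
    then have "(s - x * h) *\<^sub>R v = (h * x) *\<^sub>R v - (c * g) *\<^sub>R v" by (simp only: scaleR_diff_left)
    then show ?thesis by (simp add: scaleR_add_right)
  qed
  have "integral\<^sup>L lborel ?f = 0"
  proof (rule integral_derivative_eq_0)
    fix x
    have "sqrt (2 * real (Suc k)) * herm (Suc k) x = 2 * x * herm k x - sqrt (2 * real k) * herm (k - 1) x"
    proof -
      have "sqrt (2 * real (Suc k)) * herm (Suc k) x
        = sqrt 2 * (sqrt 2 * x * herm k x - sqrt (real k) * herm (k - 1) x)"
        using herm_rec[of x k] by (simp add: real_sqrt_mult del: of_nat_Suc)
      also have "\<dots> = (sqrt 2 * sqrt 2) * x * herm k x - sqrt (2 * real k) * herm (k - 1) x"
        by (simp only: real_sqrt_mult algebra_simps)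
      finally show ?thesis by simp
    qed
    then have e: "herm k x *\<^sub>R \<phi>' x + (sqrt (2 * real k) * herm (k - 1) x - x * herm k x) *\<^sub>R \<phi> x = ?f x"
      by (rule aux)
    show "((\<lambda>x. herm k x *\<^sub>R \<phi> x) has_vector_derivative ?f x) (at x)"
      using has_vector_derivative_scaleR[OF DERIV_herm \<phi>(1), of k x] unfolding e .
  next
    show "rapid_fun (\<lambda>x. herm k x *\<^sub>R \<phi> x)" by (intro rapid_fun_scaleR rapid_fun_herm \<phi>)
    show "rapid_fun ?f" by (intro rapid_fun_add rapid_fun_cscale rapid_fun_scaleR rapid_fun_herm \<phi> g)
    show "continuous_on UNIV ?f" by (intro continuous_intros c g)
  qed
  moreover have "integral\<^sup>L lborel ?f
      = herm_coeff ?g k + (- sqrt (2 * real (Suc k))) *\<^sub>R herm_coeff \<phi> (Suc k)"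
    unfolding herm_coeff_def
    by (subst Bochner_Integration.integral_add)
      (use integrable_herm_scaleR[OF g] integrable_herm_scaleR[OF \<phi>(2) c] in \<open>auto simp del: scaleR_scaleR of_nat_Suc\<close>)
  ultimately show ?thesis by (simp del: of_nat_Suc)
qed

text \<open>For \<open>herm j\<close> the terms with factor \<open>x\<close> cancel in
  \<open>x + d/dx\<close>, leaving a multiple of \<open>herm (j - 1)\<close>. Both indices thus drop
  by one, which reduces orthonormality to index 0.\<close>

lemma herm_coeff_herm_Suc:
  "sqrt (2 * real (Suc k)) * herm_coeff (herm j) (Suc k) = sqrt (2 * real j) * herm_coeff (herm (j - 1)) k"
proof -
  have r: "rapid_fun (\<lambda>x. sqrt (2 * real j) *\<^sub>R herm (j - 1) x + (- 1) *\<^sub>R (x *\<^sub>R herm j x))"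
    by (intro rapid_fun_add rapid_fun_cscale rapid_fun_xscale rapid_fun_herm)
  have "sqrt (2 * real (Suc k)) *\<^sub>R herm_coeff (herm j) (Suc k)
    = herm_coeff (\<lambda>x. x *\<^sub>R herm j x + (sqrt (2 * real j) * herm (j - 1) x - x * herm j x)) k"
    by (rule herm_coeff_Suc[OF DERIV_herm[unfolded has_real_derivative_iff_has_vector_derivative] rapid_fun_herm])
      (use r in \<open>auto intro!: continuous_intros\<close>)
  also have "\<dots> = sqrt (2 * real j) * herm_coeff (herm (j - 1)) k"
    unfolding herm_coeff_def
    by (subst Bochner_Integration.integral_mult_right_zero[symmetric]) (simp add: ac_simps)
  finally show ?thesis by simp
qed

lemma herm_coeff_herm: "herm_coeff (herm j) k = (if j = k then 1 else 0)"
proof (induction k arbitrary: j)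
  case 0
  show ?case
  proof (cases j)
    case 0
    have "has_bochner_integral lborel (\<lambda>x::real. exp (- x\<^sup>2)) (2 *\<^sub>R (sqrt pi / 2))"
      using has_bochner_integral_even_function[OF gaussian_moment_0] by simp
    then have i: "(\<integral>x. exp (- (x::real)\<^sup>2) \<partial>lborel) = sqrt pi"
      by (simp add: has_bochner_integral_iff)
    have "herm 0 x *\<^sub>R herm 0 x = (1 / sqrt pi) * exp (- x\<^sup>2)" for x
    proof -
      have "herm 0 x *\<^sub>R herm 0 x = (pi powr (-1/4) * pi powr (-1/4)) * (exp (- x\<^sup>2 / 2) * exp (- x\<^sup>2 / 2))"
        by simp
      also have "pi powr (-1/4) * pi powr (-1/4) = 1 / sqrt pi"
      proof -
        have "pi powr (-1/4) * pi powr (-1/4) = pi powr (-(1/2))"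
          by (simp flip: powr_add)
        also have "\<dots> = 1 / sqrt pi"
          by (simp only: powr_minus_divide powr_half_sqrt[OF pi_ge_zero])
        finally show ?thesis .
      qed
      also have "exp (- x\<^sup>2 / 2) * exp (- x\<^sup>2 / 2) = exp (- x\<^sup>2)"
        by (simp flip: exp_add)
      finally show ?thesis .
    qed
    then have "herm_coeff (herm 0) 0 = 1"
      unfolding herm_coeff_def using i by simp
    then show ?thesis using 0 by (simp del: herm.simps)
  next
    case (Suc i)
    \<comment> \<open>The integral is symmetric in the two indices; after the swap the descent
      applies, and its factor \<open>sqrt (2 * real 0)\<close> gives zero.\<close>
    have "herm_coeff (herm j) 0 = herm_coeff (herm 0) j"
      unfolding herm_coeff_def by (simp add: mult.commute)
    moreover have "herm_coeff (herm 0) (Suc i) = 0"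
      using herm_coeff_herm_Suc[of i 0] by simp
    ultimately show ?thesis using Suc by simp
  qed
next
  case (Suc k)
  have e: "sqrt (2 * real (Suc k)) * herm_coeff (herm j) (Suc k) = sqrt (2 * real j) * (if j - 1 = k then 1 else 0)"
    using herm_coeff_herm_Suc[of k j] Suc by simp
  have nz: "sqrt (2 * real (Suc k)) \<noteq> 0" by simp
  show ?case
  proof (cases "j = Suc k")
    case True
    then show ?thesis using e nz by (auto simp del: of_nat_Suc)
  next
    case False
    \<comment> \<open>For \<open>j = k = 0\<close> truncation makes \<open>j - 1 = k\<close> true,
      but the factor \<open>sqrt (2 * real j)\<close> is then zero.\<close>
    then have "sqrt (2 * real j) * (if j - 1 = k then 1 else 0) = 0" by auto
    then show ?thesis using e nz False by (auto simp del: of_nat_Suc)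
  qed
qed

lemma integrable_herm_mult: "integrable lborel (\<lambda>x. herm j x * herm k x)"
  using integrable_herm_scaleR[OF rapid_fun_herm, of k j] by (simp add: continuous_intros)

lemma integral_herm_mult: "(\<integral>x. herm j x * herm k x \<partial>lborel) = (if j = k then 1 else 0)"
  using herm_coeff_herm[of k j] by (auto simp: herm_coeff_def)

text \<open>Integrate \<open>(h\<^sup>2)' = 2 h h' \<le> h\<^sup>2 + h'\<^sup>2\<close> from \<open>-\<infinity>\<close>; the ladder relation and orthonormality
  evaluate the integral of the right-hand side as \<open>k + 3/2\<close>.\<close>

lemma herm_bound: "\<bar>herm k x\<bar> \<le> real k + 2"
proof -
  define a where "a = sqrt (real k / 2)"
  define b where "b = sqrt (real (Suc k) / 2)"
  define h' where "h' x = a * herm (k - 1) x - b * herm (Suc k) x" for x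
  have D: "(herm k has_real_derivative h' x) (at x)" for x
    using DERIV_herm_ladder[of k x] by (simp add: h'_def a_def b_def)
  let ?E = "\<lambda>x. herm k x * herm k x + (a\<^sup>2 * (herm (k - 1) x * herm (k - 1) x)
     - 2 * a * b * (herm (k - 1) x * herm (Suc k) x) + b\<^sup>2 * (herm (Suc k) x * herm (Suc k) x))"
  have E: "?E x = (herm k x)\<^sup>2 + (h' x)\<^sup>2" for x
    by (simp add: h'_def power2_eq_square algebra_simps)
  have iE: "integrable lborel ?E"
    by (intro Bochner_Integration.integrable_add Bochner_Integration.integrable_diff
        integrable_mult_right integrable_herm_mult)
  have "integral\<^sup>L lborel ?E = 1 + (a\<^sup>2 + b\<^sup>2)"
    by (simp add: integrable_herm_mult integral_herm_mult)
  also have "\<dots> = real k + 3/2"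
    by (simp add: a_def b_def field_simps)
  finally have IE: "integral\<^sup>L lborel ?E = real k + 3/2" .
  have step: "(herm k x)\<^sup>2 - (herm k y)\<^sup>2 \<le> real k + 3/2" if "y \<le> x" for y
  proof -
    have c: "isCont (\<lambda>z. 2 * herm k z * h' z) z" for z
      unfolding h'_def by (intro continuous_intros DERIV_isCont[OF DERIV_herm])
    have d: "((\<lambda>z. (herm k z)\<^sup>2) has_real_derivative 2 * herm k z * h' z) (at z)" for z
      by (rule DERIV_cong[OF DERIV_power[OF D]]) simp
    have hb: "has_bochner_integral lborel (\<lambda>z. (2 * herm k z * h' z) * indicator {y..x} z) ((herm k x)\<^sup>2 - (herm k y)\<^sup>2)"
      by (rule has_bochner_integral_FTC_Icc_real[OF that]) (use c d in auto)
    have "(herm k x)\<^sup>2 - (herm k y)\<^sup>2 = (\<integral>z. (2 * herm k z * h' z) * indicator {y..x} z \<partial>lborel)"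
      using hb by (simp add: has_bochner_integral_iff)
    also have "\<dots> \<le> integral\<^sup>L lborel ?E"
    proof (rule integral_mono[OF _ iE])
      show "integrable lborel (\<lambda>z. (2 * herm k z * h' z) * indicator {y..x} z)"
        using hb by (simp add: has_bochner_integral_iff)
      fix z
      have "2 * herm k z * h' z \<le> (herm k z)\<^sup>2 + (h' z)\<^sup>2" by (rule sum_squares_bound)
      then show "(2 * herm k z * h' z) * indicator {y..x} z \<le> ?E z"
        unfolding E by (auto split: split_indicator)
    qed
    finally show ?thesis unfolding IE .
  qed
  have "((\<lambda>y. (herm k x)\<^sup>2 - (herm k y)\<^sup>2) \<longlongrightarrow> (herm k x)\<^sup>2 - 0\<^sup>2) at_bot"
    by (intro tendsto_intros tendsto_mono[OF at_bot_le_at_infinity rapid_fun_tendsto_0[OF rapid_fun_herm]])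
  then have "(herm k x)\<^sup>2 - 0\<^sup>2 \<le> real k + 3/2"
    by (rule tendsto_upperbound) (auto intro: step eventually_mono[OF eventually_le_at_bot[of x]])
  also have "\<dots> \<le> (real k + 2)\<^sup>2" by (simp add: power2_eq_square algebra_simps)
  finally have "\<bar>herm k x\<bar>\<^sup>2 \<le> (real k + 2)\<^sup>2" by simp
  then show ?thesis by (rule power2_le_imp_le) simp
qed

section \<open>The transform as a power series\<close>

text \<open>The formal series \<open>G\<close> for \<open>exp (y X - X\<^sup>2/2)\<close> satisfies
  \<open>G' = (y - X) G\<close>. Comparing coefficients gives the Hermite recurrence up to the
  scaling by \<open>sqrt (fact k)\<close>. Evaluation at \<open>q\<close> is a Cauchy product of two
  absolutely convergent series in powers of \<open>q\<close>, so commutativity of the algebra is not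
  at issue.\<close>

lemma herm_generating_function:
  fixes q :: "'a::{real_normed_algebra_1,banach}"
  shows "(\<lambda>k. (herm k x / sqrt (fact k)) *\<^sub>R q ^ k) sums
    ((pi powr (-1/4) * exp (- x\<^sup>2 / 2)) *\<^sub>R (exp ((sqrt 2 * x) *\<^sub>R q) * exp ((-1/2) *\<^sub>R q\<^sup>2)))"
proof -
  define y where "y = sqrt 2 * x"
  define w where "w = pi powr (-1/4) * exp (- x\<^sup>2 / 2)"
  define A where "A = fps_exp y"
  \<comment> \<open>The formal power series of \<open>exp (- X\<^sup>2/2)\<close>; only even powers
    occur.\<close>
  define B where "B = Abs_fps (\<lambda>n. if even n then (-1/2) ^ (n div 2) / fact (n div 2) else 0 :: real)"
  define G where "G = A * B"
  have dB: "fps_deriv B = - (fps_X * B)"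
  proof (rule fps_ext)
    fix n
    show "fps_nth (fps_deriv B) n = fps_nth (- (fps_X * B)) n"
    proof (cases "odd n")
      case True
      then obtain m where m: "n = Suc (2 * m)" by (metis oddE Suc_eq_plus1)
      have "fps_nth B (Suc (Suc (2 * m))) = (-1/2) ^ Suc m / fact (Suc m)" by (simp add: B_def)
      moreover have "fps_nth B (2 * m) = (-1/2) ^ m / fact m" by (simp add: B_def)
      moreover have "(2 * real m + 2) * ((-1/2) ^ Suc m / fact (Suc m)) = - ((-1/2) ^ m / fact m :: real)"
        by (simp add: divide_simps)
      ultimately show ?thesis by (simp add: m add.commute del: power_Suc fact_Suc)
    qed (auto simp: B_def elim!: evenE)
  qed
  have "fps_deriv G = fps_const y * G - fps_X * G"
    unfolding G_def by (simp add: dB A_def fps_exp_deriv algebra_simps)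
  then have "fps_nth (fps_deriv G) k = y * fps_nth G k - (if k = 0 then 0 else fps_nth G (k - 1))" for k
    by simp
  then have Grec: "real (Suc k) * fps_nth G (Suc k) = y * fps_nth G k - (if k = 0 then 0 else fps_nth G (k - 1))" for k
    by simp
  have hG: "herm k x / sqrt (fact k) = w * fps_nth G k" for k
  proof -
    have "herm k x = w * sqrt (fact k) * fps_nth G k"
    proof (induction k rule: less_induct)
      case (less k)
      show ?case
      proof (cases k)
        case 0
        then show ?thesis by (simp add: w_def G_def A_def B_def)
      next
        case (Suc j)
        have "sqrt (real (Suc j)) * herm (Suc j) x = y * herm j x - sqrt (real j) * herm (j - 1) x"
          using herm_rec[of x j] by (simp add: y_def)
        also have "\<dots> = w * sqrt (fact j) * (y * fps_nth G j - (if j = 0 then 0 else fps_nth G (j - 1)))"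
        proof (cases j)
          case 0
          then show ?thesis using less[of j] Suc by simp
        next
          case (Suc i)
          have "sqrt (real (Suc i)) * sqrt (real (Suc i)) = real (Suc i)" by simp
          then show ?thesis using less[of j] less[of i] Suc \<open>k = Suc j\<close>
            by (simp add: real_sqrt_mult algebra_simps del: of_nat_Suc)
        qed
        also have "\<dots> = w * sqrt (fact j) * (real (Suc j) * fps_nth G (Suc j))" by (simp only: Grec)
        also have "\<dots> = sqrt (real (Suc j)) * (w * sqrt (fact (Suc j)) * fps_nth G (Suc j))"
        proof -
          have "real (Suc j) = sqrt (real (Suc j)) * sqrt (real (Suc j))" by simp
          then have "real (Suc j) * z = sqrt (real (Suc j)) * (sqrt (real (Suc j)) * z)" for z
            by (metis mult.assoc)
          moreover have "sqrt (fact (Suc j)) = sqrt (real (Suc j)) * sqrt (fact j)"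
            by (simp add: real_sqrt_mult del: of_nat_Suc)
          ultimately show ?thesis by (simp add: mult_ac del: of_nat_Suc fact_Suc)
        qed
        finally have "herm (Suc j) x = w * sqrt (fact (Suc j)) * fps_nth G (Suc j)"
          by (simp del: of_nat_Suc fact_Suc)
        then show ?thesis using Suc by simp
      qed
    qed
    then show ?thesis by simp
  qed
  define a where "a k = fps_nth A k *\<^sub>R q ^ k" for k
  define b where "b k = fps_nth B k *\<^sub>R q ^ k" for k
  have ae: "a k = (y *\<^sub>R q) ^ k /\<^sub>R fact k" for k
    by (simp add: a_def A_def divide_inverse_commute)
  have be: "b (2 * m) = ((-1/2) *\<^sub>R q\<^sup>2) ^ m /\<^sub>R fact m" for m
  proof -
    have "fps_nth B (2 * m) = inverse (fact m) * (-1/2) ^ m" by (simp add: B_def field_simps)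
    then show ?thesis by (simp only: b_def power_mult scaleR_power scaleR_scaleR)
  qed
  have b0: "b n = 0" if "n \<notin> range (\<lambda>m. 2 * m)" for n
    using that by (auto simp: b_def B_def elim!: evenE)
  \<comment> \<open>Reindexing along the even numbers identifies the sum of \<open>b\<close> with
    the exponential series at \<open>(-1/2) *\<^sub>R q\<^sup>2\<close>.\<close>
  have sm: "strict_mono (\<lambda>m::nat. 2 * m)" by (simp add: strict_mono_def)
  have a: "summable (\<lambda>k. norm (a k))" "a sums exp (y *\<^sub>R q)"
    unfolding ae by (rule summable_norm_exp) (rule exp_converges)
  have b: "b sums exp ((-1/2) *\<^sub>R q\<^sup>2)"
    using sums_mono_reindex[OF sm, of b] b0 exp_converges[of "(-1/2) *\<^sub>R q\<^sup>2"] by (simp add: be)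
  have b': "summable (\<lambda>k. norm (b k))"
    using summable_mono_reindex[OF sm, of "\<lambda>k. norm (b k)"] b0 summable_norm_exp[of "(-1/2) *\<^sub>R q\<^sup>2"]
    by (simp add: be)
  have "(\<Sum>i\<le>k. a i * b (k - i)) = fps_nth G k *\<^sub>R q ^ k" for k
  proof -
    have "a i * b (k - i) = (fps_nth A i * fps_nth B (k - i)) *\<^sub>R q ^ k" if "i \<le> k" for i
      using that by (simp add: a_def b_def mult.commute flip: power_add)
    then have "(\<Sum>i\<le>k. a i * b (k - i)) = (\<Sum>i\<le>k. (fps_nth A i * fps_nth B (k - i)) *\<^sub>R q ^ k)" by simp
    then show ?thesis by (simp add: G_def fps_mult_nth scaleR_sum_left atMost_atLeast0)
  qed
  then have "(\<lambda>k. fps_nth G k *\<^sub>R q ^ k) sums (exp (y *\<^sub>R q) * exp ((-1/2) *\<^sub>R q\<^sup>2))"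
    using Cauchy_product_sums[OF a(1) b'] a(2) b by (simp add: sums_iff)
  then have "(\<lambda>k. w *\<^sub>R (fps_nth G k *\<^sub>R q ^ k)) sums (w *\<^sub>R (exp (y *\<^sub>R q) * exp ((-1/2) *\<^sub>R q\<^sup>2)))"
    by (rule sums_scaleR_right)
  then show ?thesis by (simp only: hG scaleR_scaleR flip: y_def w_def)
qed

text \<open>The exponent is a sum of a real number and real multiples of \<open>q\<close> and
  \<open>q\<^sup>2\<close>. These commute, so the exponential factors as over the reals and the
  generating function applies.\<close>

lemma SB_kernel_sums:
  "(\<lambda>k. (pi powr (-1/2) / sqrt (fact k) * herm k x) *\<^sub>R q ^ k) sums SB_kernel q x"
proof -
  have e: "- ((1/2) *\<^sub>R (q\<^sup>2 + of_real (x\<^sup>2))) + sqrt 2 *\<^sub>R (q * of_real x)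
     = of_real (- x\<^sup>2 / 2) + ((sqrt 2 * x) *\<^sub>R q + (-1/2) *\<^sub>R q\<^sup>2)"
    unfolding of_real_def
    by (simp only: quat_eq_iff quat_add_sel quat_scaleR_sel quat_mult_sel) (simp add: algebra_simps)
  have "exp (- ((1/2) *\<^sub>R (q\<^sup>2 + of_real (x\<^sup>2))) + sqrt 2 *\<^sub>R (q * of_real x))
     = exp (of_real (- x\<^sup>2 / 2)) * exp ((sqrt 2 * x) *\<^sub>R q + (-1/2) *\<^sub>R q\<^sup>2)"
    unfolding e
    by (rule exp_add_commuting) (simp only: of_real_def mult_scaleR_left mult_scaleR_right mult_1_left mult_1_right)
  also have "exp ((sqrt 2 * x) *\<^sub>R q + (-1/2) *\<^sub>R q\<^sup>2) = exp ((sqrt 2 * x) *\<^sub>R q) * exp ((-1/2) *\<^sub>R q\<^sup>2)"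
    by (rule exp_add_commuting) (simp add: power2_eq_square mult.assoc)
  also have "exp (of_real (- x\<^sup>2 / 2) :: quat) = of_real (exp (- x\<^sup>2 / 2))"
    by (rule exp_of_real)
  finally have k: "SB_kernel q x = pi powr (-3/4) *\<^sub>R
      (exp (- x\<^sup>2 / 2) *\<^sub>R (exp ((sqrt 2 * x) *\<^sub>R q) * exp ((-1/2) *\<^sub>R q\<^sup>2)))"
    by (simp add: SB_kernel_def scaleR_conv_of_real mult.assoc)
  have p: "pi powr (-3/4) = pi powr (-1/2) * pi powr (-1/4)"
    by (simp flip: powr_add)
  have "SB_kernel q x = pi powr (-1/2) *\<^sub>R
      ((pi powr (-1/4) * exp (- x\<^sup>2 / 2)) *\<^sub>R (exp ((sqrt 2 * x) *\<^sub>R q) * exp ((-1/2) *\<^sub>R q\<^sup>2)))"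
    unfolding k p by (simp only: scaleR_scaleR mult.assoc)
  with sums_scaleR_right[OF herm_generating_function[of x q], of "pi powr (-1/2)"]
  show ?thesis by (simp add: mult.commute)
qed

text \<open>The factor \<open>real k + 2\<close> is the growth allowed by \<open>herm_bound\<close>.
  The square root of the factorial is removed by
  \<open>2 * u * v \<le> u\<^sup>2 + v\<^sup>2\<close>, which leaves an exponential and a geometric
  series.\<close>

lemma summable_power_div_sqrt_fact:
  "summable (\<lambda>k. (real k + 2) * r ^ k / sqrt (fact k))" if "r \<ge> 0"
proof (rule summable_comparison_test')
  show "summable (\<lambda>k. inverse (fact k) * ((4 * r)\<^sup>2) ^ k + (1/4) ^ k)"
    by (intro summable_add summable_exp summable_geometric) simp
  fix k :: nat
  have s: "real k + 2 \<le> 2 * 2 ^ k"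
  proof (induction k)
    case (Suc k)
    have "1 \<le> (2::real) * 2 ^ k" using one_le_power[of "2::real" k] by linarith
    then show ?case using Suc by simp
  qed simp
  define u where "u = (4 * r) ^ k / sqrt (fact k)"
  define v where "v = (1/2 :: real) ^ k"
  have "norm ((real k + 2) * r ^ k / sqrt (fact k)) = (real k + 2) * r ^ k / sqrt (fact k)"
    using that by simp
  also have "\<dots> \<le> (2 * 2 ^ k) * r ^ k / sqrt (fact k)"
    using that s by (intro divide_right_mono mult_right_mono) auto
  \<comment> \<open>Of the two factors \<open>2 ^ k\<close> contained in \<open>4 ^ k\<close>, one
    is the bound for \<open>real k + 2\<close> and the other cancels \<open>v\<close>.\<close>
  also have "\<dots> = 2 * u * v"
  proof -
    have "(4 * r) ^ k = (2 * 2 * r) ^ k" by simp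
    then have "(4 * r) ^ k = 2 ^ k * 2 ^ k * r ^ k" by (simp only: power_mult_distrib)
    then have "2 * u * v = 2 * (2 ^ k * (2 ^ k * v)) * r ^ k / sqrt (fact k)"
      by (simp only: u_def times_divide_eq_left times_divide_eq_right mult_ac)
    moreover have "2 ^ k * v = 1" by (simp add: v_def power_one_over)
    ultimately show ?thesis by simp
  qed
  also have "\<dots> \<le> u\<^sup>2 + v\<^sup>2" by (rule sum_squares_bound)
  also have "\<dots> = inverse (fact k) * ((4 * r)\<^sup>2) ^ k + (1/4) ^ k"
  proof -
    have c: "(z ^ k)\<^sup>2 = (z\<^sup>2) ^ k" for z :: real by (metis power_mult mult.commute)
    have "u\<^sup>2 = ((4 * r)\<^sup>2) ^ k / fact k" by (simp only: u_def power_divide c) simp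
    moreover have "v\<^sup>2 = (1/4) ^ k" by (simp only: v_def c) (simp add: power2_eq_square)
    ultimately show ?thesis by (simp only: divide_inverse_commute)
  qed
  finally show "norm ((real k + 2) * r ^ k / sqrt (fact k)) \<le> inverse (fact k) * ((4 * r)\<^sup>2) ^ k + (1/4) ^ k" .
qed

definition SB_coeff :: "(real \<Rightarrow> quat) \<Rightarrow> nat \<Rightarrow> quat" where
  "SB_coeff \<phi> k = (pi powr (-1/2) / sqrt (fact k)) *\<^sub>R herm_coeff \<phi> k"

text \<open>Sum and integral are interchanged under the majorant
  \<open>e k * norm (\<phi> x)\<close>, with \<open>e\<close> summable. The Hermite weights are
  real, so \<open>q ^ k\<close> can be pulled out on the left and the coefficient stays on the
  right.\<close>

lemma SB_transform_sums:
  assumes \<phi>: "rapid_fun \<phi>" "continuous_on UNIV \<phi>"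
  shows "(\<lambda>k. q ^ k * SB_coeff \<phi> k) sums SB_transform \<phi> q"
proof -
  define d where "d k = pi powr (-1/2) / sqrt (fact k)" for k :: nat
  have d: "d k \<ge> 0" for k by (simp add: d_def)
  define f where "f k x = (d k *\<^sub>R q ^ k) * (herm k x *\<^sub>R \<phi> x)" for k x
  define e where "e k = pi powr (-1/2) * ((real k + 2) * norm q ^ k / sqrt (fact k))" for k
  have e: "summable e" unfolding e_def
    by (intro summable_mult summable_power_div_sqrt_fact) simp
  have i: "integrable lborel (f k)" for k
    unfolding f_def by (intro integrable_mult_right integrable_herm_scaleR \<phi>)
  have i\<phi>: "integrable lborel \<phi>" using \<phi> by (rule rapid_fun_integrable)
  have b: "norm (f k x) \<le> e k * norm (\<phi> x)" for k x
  proof -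
    have "norm (f k x) = d k * norm q ^ k * (\<bar>herm k x\<bar> * norm (\<phi> x))"
      using d[of k] by (simp add: f_def norm_mult norm_power abs_mult)
    also have "\<dots> \<le> d k * norm q ^ k * ((real k + 2) * norm (\<phi> x))"
      by (intro mult_left_mono mult_right_mono herm_bound) (use d in auto)
    also have "\<dots> = e k * norm (\<phi> x)" by (simp add: e_def d_def)
    finally show ?thesis .
  qed
  have e0: "e k \<ge> 0" for k by (simp add: e_def)
  have "(\<lambda>k. integral\<^sup>L lborel (f k)) sums (\<integral>x. (\<Sum>k. f k x) \<partial>lborel)"
  proof (rule sums_integral[OF i])
    show "AE x in lborel. summable (\<lambda>k. norm (f k x))"
      by (intro AE_I2 summable_comparison_test'[OF summable_mult2[OF e]]) (use b in auto)
    show "summable (\<lambda>k. \<integral>x. norm (f k x) \<partial>lborel)"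
    proof (rule summable_comparison_test'[OF summable_mult2[OF e]])
      fix k
      have "(\<integral>x. norm (f k x) \<partial>lborel) \<le> (\<integral>x. e k * norm (\<phi> x) \<partial>lborel)"
        by (intro integral_mono integrable_norm i integrable_mult_right i\<phi> b)
      then show "norm (\<integral>x. norm (f k x) \<partial>lborel) \<le> e k * (\<integral>x. norm (\<phi> x) \<partial>lborel)"
        by simp
    qed
  qed
  moreover have "integral\<^sup>L lborel (f k) = q ^ k * SB_coeff \<phi> k" for k
  proof -
    have "integral\<^sup>L lborel (f k) = (d k *\<^sub>R q ^ k) * herm_coeff \<phi> k"
      unfolding f_def herm_coeff_def
      by (rule Bochner_Integration.integral_mult_right) (intro integrable_herm_scaleR \<phi>)
    then show ?thesis by (simp add: SB_coeff_def d_def)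
  qed
  moreover have "(\<Sum>k. f k x) = SB_kernel q x * \<phi> x" for x
  proof -
    have "(\<lambda>k. ((d k * herm k x) *\<^sub>R q ^ k) * \<phi> x) sums (SB_kernel q x * \<phi> x)"
      unfolding d_def by (intro sums_mult2 SB_kernel_sums)
    then show ?thesis by (simp add: sums_iff f_def mult.commute)
  qed
  ultimately show ?thesis by (simp add: SB_transform_def)
qed

section \<open>Schwartz functions and rapidly decreasing Hermite coefficients\<close>

abbreviation vderiv :: "(real \<Rightarrow> quat) \<Rightarrow> real \<Rightarrow> quat" where
  "vderiv f \<equiv> \<lambda>x. vector_derivative f (at x)"

lemma iter_deriv_vderiv: "iter_deriv n (vderiv f) = iter_deriv (Suc n) f"
  by (simp add: iter_deriv_def funpow_Suc_right del: funpow.simps)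

lemma schwartz_quat_vderiv: "f \<in> schwartz_quat \<Longrightarrow> vderiv f \<in> schwartz_quat"
  unfolding schwartz_quat_def by (simp add: iter_deriv_vderiv)

lemma schwartz_quat_has_vector_derivative:
  assumes "f \<in> schwartz_quat"
  shows "(f has_vector_derivative vderiv f x) (at x)"
proof -
  have "iter_deriv 0 f differentiable (at x)" using assms unfolding schwartz_quat_def by blast
  then show ?thesis by (simp add: iter_deriv_def vector_derivative_works)
qed

lemma schwartz_quat_rapid_fun:
  assumes "f \<in> schwartz_quat"
  shows "rapid_fun f"
  unfolding rapid_fun_def
proof
  fix m
  have "bdd_above (range (\<lambda>x. norm (x ^ m *\<^sub>R iter_deriv 0 f x)))"
    by (rule assms[unfolded schwartz_quat_def, THEN CollectD, THEN conjunct2, THEN spec, THEN spec])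
  then show "\<exists>C. \<forall>x. \<bar>x\<bar> ^ m * norm (f x) \<le> C"
    by (auto simp: bdd_above_def iter_deriv_def power_abs)
qed

lemma schwartz_quat_continuous: "f \<in> schwartz_quat \<Longrightarrow> continuous_on UNIV f"
  by (intro continuous_at_imp_continuous_on ballI)
    (use schwartz_quat_has_vector_derivative has_vector_derivative_continuous in blast)

text \<open>A class of rapidly decaying functions that is closed under differentiation consists of
  Schwartz functions: by uniqueness of derivatives all iterates of \<open>vderiv\<close> stay in the
  class. No formula for higher derivatives is then needed.\<close>

lemma schwartz_quat_coinduct:
  assumes f: "f \<in> X"
    and rapid: "\<And>f. f \<in> X \<Longrightarrow> rapid_fun f"
    and deriv: "\<And>f. f \<in> X \<Longrightarrow> \<exists>f'\<in>X. \<forall>x. (f has_vector_derivative f' x) (at x)"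
  shows "f \<in> schwartz_quat"
proof -
  have X: "iter_deriv n f \<in> X" for n
  proof (induction n)
    case (Suc n)
    then obtain f' where f': "f' \<in> X" "\<And>x. (iter_deriv n f has_vector_derivative f' x) (at x)"
      using deriv by blast
    have "iter_deriv (Suc n) f = vderiv (iter_deriv n f)" by (simp add: iter_deriv_def)
    also have "\<dots> = f'" using f'(2) by (auto intro: vector_derivative_at)
    finally show ?case using f' by simp
  qed (simp add: iter_deriv_def f)
  show ?thesis
    unfolding schwartz_quat_def
  proof (intro CollectI conjI allI)
    fix n x
    show "iter_deriv n f differentiable (at x)"
      using deriv[OF X] differentiableI_vector by blast
  next
    fix m n
    obtain C where "\<And>x. \<bar>x\<bar> ^ m * norm (iter_deriv n f x) \<le> C"
      using rapid_funE[OF rapid[OF X]] by blast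
    then show "bdd_above (range (\<lambda>x. norm (x ^ m *\<^sub>R iter_deriv n f x)))"
      by (intro bdd_aboveI2[where M = C]) (simp add: power_abs)
  qed
qed

lemma schwartz_quat_add:
  assumes "f \<in> schwartz_quat" "g \<in> schwartz_quat"
  shows "(\<lambda>x. f x + g x) \<in> schwartz_quat"
proof (rule schwartz_quat_coinduct)
  let ?F = "\<lambda>(u, v) x. u x + v x :: quat"
  let ?X = "?F ` (schwartz_quat \<times> schwartz_quat)"
  show "(\<lambda>x. f x + g x) \<in> ?X" using assms by (intro image_eqI[of _ ?F "(f, g)"]) auto
  fix h assume "h \<in> ?X"
  then obtain u v where h: "h = (\<lambda>x. u x + v x)" "u \<in> schwartz_quat" "v \<in> schwartz_quat" by auto
  show "rapid_fun h" unfolding h by (intro rapid_fun_add schwartz_quat_rapid_fun h)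
  show "\<exists>f'\<in>?X. \<forall>x. (h has_vector_derivative f' x) (at x)"
  proof (intro bexI allI)
    show "(h has_vector_derivative (vderiv u x + vderiv v x)) (at x)" for x
      unfolding h by (intro has_vector_derivative_add schwartz_quat_has_vector_derivative h)
    show "(\<lambda>x. vderiv u x + vderiv v x) \<in> ?X"
      using schwartz_quat_vderiv h by (intro image_eqI[of _ ?F "(vderiv u, vderiv v)"]) auto
  qed
qed

text \<open>The summand \<open>g\<close> makes the form stable under differentiation: the derivative
  is \<open>x *\<^sub>R f' + (f + g')\<close>.\<close>

lemma schwartz_quat_xscale_add:
  assumes "f \<in> schwartz_quat" "g \<in> schwartz_quat"
  shows "(\<lambda>x. x *\<^sub>R f x + g x) \<in> schwartz_quat"
proof (rule schwartz_quat_coinduct)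
  let ?F = "\<lambda>(u, v) x. x *\<^sub>R u x + v x :: quat"
  let ?X = "?F ` (schwartz_quat \<times> schwartz_quat)"
  show "(\<lambda>x. x *\<^sub>R f x + g x) \<in> ?X" using assms by (intro image_eqI[of _ ?F "(f, g)"]) auto
  fix h assume "h \<in> ?X"
  then obtain u v where h: "h = (\<lambda>x. x *\<^sub>R u x + v x)" "u \<in> schwartz_quat" "v \<in> schwartz_quat" by auto
  show "rapid_fun h" unfolding h by (intro rapid_fun_add rapid_fun_xscale schwartz_quat_rapid_fun h)
  show "\<exists>f'\<in>?X. \<forall>x. (h has_vector_derivative f' x) (at x)"
  proof (intro bexI allI)
    show "(h has_vector_derivative (x *\<^sub>R vderiv u x + (u x + vderiv v x))) (at x)" for x
    proof -
      have "(h has_vector_derivative ((x *\<^sub>R vderiv u x + 1 *\<^sub>R u x) + vderiv v x)) (at x)"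
        unfolding h by (intro has_vector_derivative_add has_vector_derivative_scaleR DERIV_ident
            schwartz_quat_has_vector_derivative h)
      then show ?thesis by (simp add: add.assoc)
    qed
    show "(\<lambda>x. x *\<^sub>R vderiv u x + (u x + vderiv v x)) \<in> ?X"
      using schwartz_quat_vderiv schwartz_quat_add h
      by (intro image_eqI[of _ ?F "(vderiv u, \<lambda>x. u x + vderiv v x)"]) auto
  qed
qed

section \<open>Rapidly decreasing sequences\<close>

text \<open>The weight uses \<open>Suc k\<close> so that it does not vanish at
  \<open>k = 0\<close>.\<close>

definition rapid_seq :: "(nat \<Rightarrow> 'a::real_normed_vector) \<Rightarrow> bool" where
  "rapid_seq a \<longleftrightarrow> (\<forall>m::nat. \<exists>C. \<forall>k. norm (a k) * real (Suc k) ^ m \<le> C)"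

lemma norm_herm_coeff_le:
  fixes \<phi> :: "real \<Rightarrow> 'a::euclidean_space"
  assumes "rapid_fun \<phi>" "continuous_on UNIV \<phi>"
  shows "norm (herm_coeff \<phi> k) \<le> (real k + 2) * (\<integral>x. norm (\<phi> x) \<partial>lborel)"
proof -
  have "norm (herm_coeff \<phi> k) \<le> (\<integral>x. norm (herm k x *\<^sub>R \<phi> x) \<partial>lborel)"
    unfolding herm_coeff_def by (rule integral_norm_bound)
  also have "\<dots> \<le> (\<integral>x. (real k + 2) * norm (\<phi> x) \<partial>lborel)"
    using herm_bound[of k]
    by (intro integral_mono integrable_norm integrable_herm_scaleR integrable_mult_right
        rapid_fun_integrable assms) (auto intro: mult_right_mono)
  finally show ?thesis by simp
qed

lemma rapid_seq_herm_coeff: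
  assumes "\<phi> \<in> schwartz_quat"
  shows "rapid_seq (herm_coeff \<phi>)"
proof -
  \<comment> \<open>Squared norms avoid half-integer exponents: each integration by parts gains a
    full power of \<open>k\<close>. The factor on the right is the growth from
    \<open>norm_herm_coeff_le\<close>.\<close>
  have main: "\<exists>C\<ge>0. \<forall>k. (norm (herm_coeff \<phi> k))\<^sup>2 * (real k + 2) ^ m \<le> C * (real k + 2)\<^sup>2"
    if "\<phi> \<in> schwartz_quat" for m \<phi>
    using that
  proof (induction m arbitrary: \<phi>)
    case 0
    let ?I = "\<integral>x. norm (\<phi> x) \<partial>lborel"
    have "(norm (herm_coeff \<phi> k))\<^sup>2 \<le> ?I\<^sup>2 * (real k + 2)\<^sup>2" for k
      using power_mono[OF norm_herm_coeff_le[OF schwartz_quat_rapid_fun[OF 0] schwartz_quat_continuous[OF 0]], of k 2]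
      by (simp add: power_mult_distrib mult.commute)
    then show ?case by (intro exI[of _ "?I\<^sup>2"]) auto
  next
    case (Suc m)
    let ?\<psi> = "\<lambda>x. x *\<^sub>R \<phi> x + vderiv \<phi> x"
    have d: "vderiv \<phi> \<in> schwartz_quat" using Suc by (intro schwartz_quat_vderiv)
    then have "?\<psi> \<in> schwartz_quat" by (intro schwartz_quat_xscale_add Suc)
    from Suc.IH[OF this] obtain C where C: "C \<ge> 0"
      "\<And>k. (norm (herm_coeff ?\<psi> k))\<^sup>2 * (real k + 2) ^ m \<le> C * (real k + 2)\<^sup>2" by blast
    \<comment> \<open>The first summand covers \<open>k = 0\<close>, which the ladder does not
      reach. In the second, the factor 2 comes from \<open>A * (real k + 2) \<le> 2 * B\<close> and
      \<open>2 ^ m\<close> from \<open>real k + 2 \<le> 2 * (real j + 2)\<close>.\<close>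
    define D where "D = (norm (herm_coeff \<phi> 0))\<^sup>2 * 2 ^ Suc m + 2 * 2 ^ m * C"
    have "(norm (herm_coeff \<phi> k))\<^sup>2 * (real k + 2) ^ Suc m \<le> D * (real k + 2)\<^sup>2" for k
    proof (cases k)
      case 0
      have "(norm (herm_coeff \<phi> 0))\<^sup>2 * 2 ^ Suc m \<le> D * 1" using C(1) by (simp add: D_def)
      also have "\<dots> \<le> D * 2\<^sup>2" using C(1) by (intro mult_left_mono) (auto simp: D_def)
      finally show ?thesis using 0 by simp
    next
      case (Suc j)
      define A where "A = (norm (herm_coeff \<phi> (Suc j)))\<^sup>2"
      define B where "B = (norm (herm_coeff ?\<psi> j))\<^sup>2"
      have "sqrt (2 * real (Suc j)) *\<^sub>R herm_coeff \<phi> (Suc j) = herm_coeff ?\<psi> j"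
        by (rule herm_coeff_Suc)
          (use \<open>\<phi> \<in> schwartz_quat\<close> d in \<open>auto intro: schwartz_quat_has_vector_derivative
             schwartz_quat_rapid_fun schwartz_quat_continuous\<close>)
      then have "B = (norm (sqrt (2 * real (Suc j)) *\<^sub>R herm_coeff \<phi> (Suc j)))\<^sup>2" by (simp add: B_def)
      also have "\<dots> = 2 * real (Suc j) * A"
        by (simp add: A_def power_mult_distrib del: of_nat_Suc)
      finally have BA: "B = 2 * real (Suc j) * A" .
      have A0: "A \<ge> 0" by (simp add: A_def)
      have "A * (real k + 2) \<le> 2 * B"
        unfolding BA Suc using A0 by (simp add: algebra_simps)
      moreover have "(real k + 2) ^ m \<le> (2 * (real j + 2)) ^ m"
        using Suc by (intro power_mono) auto
      ultimately have "A * (real k + 2) * (real k + 2) ^ m \<le> 2 * B * (2 * (real j + 2)) ^ m"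
        using A0 by - (rule mult_mono, assumption, assumption, simp_all add: B_def)
      also have "\<dots> = 2 * 2 ^ m * (B * (real j + 2) ^ m)" by (simp only: power_mult_distrib mult_ac)
      also have "\<dots> \<le> 2 * 2 ^ m * (C * (real j + 2)\<^sup>2)"
        using C(2)[of j] by (intro mult_left_mono) (auto simp: B_def)
      also have "\<dots> \<le> 2 * 2 ^ m * (C * (real k + 2)\<^sup>2)"
        using C(1) Suc by (intro mult_left_mono power_mono) auto
      also have "\<dots> \<le> D * (real k + 2)\<^sup>2"
        by (simp add: D_def algebra_simps)
      finally show ?thesis using Suc by (simp add: A_def mult.assoc)
    qed
    moreover have "D \<ge> 0" using C(1) by (simp add: D_def)
    ultimately show ?case by blast
  qed
  show ?thesis
    unfolding rapid_seq_def
  proof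
    fix m
    \<comment> \<open>Of the exponent \<open>2 * m + 2\<close>, the part \<open>2 * m\<close> is the
      square of the desired weight and the rest cancels the growth factor.\<close>
    obtain C where C: "C \<ge> 0"
      "\<And>k. (norm (herm_coeff \<phi> k))\<^sup>2 * (real k + 2) ^ (2 * m + 2) \<le> C * (real k + 2)\<^sup>2"
      using main[OF assms] by blast
    have "norm (herm_coeff \<phi> k) * real (Suc k) ^ m \<le> sqrt C" for k
    proof -
      have "(norm (herm_coeff \<phi> k) * (real k + 2) ^ m)\<^sup>2 * (real k + 2)\<^sup>2 \<le> C * (real k + 2)\<^sup>2"
        using C(2)[of k]
        by (simp add: power_mult_distrib power_add power_mult mult_ac power2_eq_square)
      then have "(norm (herm_coeff \<phi> k) * (real k + 2) ^ m)\<^sup>2 \<le> C"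
        by (rule mult_right_le_imp_le) simp
      then have "norm (herm_coeff \<phi> k) * (real k + 2) ^ m \<le> sqrt C" by (rule real_le_rsqrt)
      moreover have "norm (herm_coeff \<phi> k) * real (Suc k) ^ m \<le> norm (herm_coeff \<phi> k) * (real k + 2) ^ m"
        by (intro mult_left_mono power_mono) auto
      ultimately show ?thesis by linarith
    qed
    then show "\<exists>C. \<forall>k. norm (herm_coeff \<phi> k) * real (Suc k) ^ m \<le> C" by blast
  qed
qed

lemma rapid_seq_scale:
  assumes "rapid_seq a" "\<And>k. \<bar>s k\<bar> \<le> real (Suc k)"
  shows "rapid_seq (\<lambda>k. s k *\<^sub>R a k)"
  unfolding rapid_seq_def
proof
  fix m
  obtain C where C: "\<And>k. norm (a k) * real (Suc k) ^ Suc m \<le> C"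
    using assms(1) unfolding rapid_seq_def by blast
  have "norm (s k *\<^sub>R a k) * real (Suc k) ^ m \<le> C" for k
  proof -
    have "norm (s k *\<^sub>R a k) * real (Suc k) ^ m = \<bar>s k\<bar> * (norm (a k) * real (Suc k) ^ m)" by simp
    also have "\<dots> \<le> real (Suc k) * (norm (a k) * real (Suc k) ^ m)"
      using assms(2) by (intro mult_right_mono) auto
    also have "\<dots> \<le> C" using C[of k] by (simp only: power_Suc mult_ac)
    finally show ?thesis .
  qed
  then show "\<exists>C. \<forall>k. norm (s k *\<^sub>R a k) * real (Suc k) ^ m \<le> C" by blast
qed

lemma rapid_seq_add:
  assumes "rapid_seq a" "rapid_seq b"
  shows "rapid_seq (\<lambda>k. a k + b k)"
  unfolding rapid_seq_def
proof
  fix m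
  obtain C where C: "\<And>k. norm (a k) * real (Suc k) ^ m \<le> C"
    using assms(1) unfolding rapid_seq_def by blast
  obtain D where D: "\<And>k. norm (b k) * real (Suc k) ^ m \<le> D"
    using assms(2) unfolding rapid_seq_def by blast
  have "norm (a k + b k) * real (Suc k) ^ m \<le> C + D" for k
  proof -
    have "norm (a k + b k) * real (Suc k) ^ m \<le> (norm (a k) + norm (b k)) * real (Suc k) ^ m"
      by (intro mult_right_mono norm_triangle_ineq) simp
    also have "\<dots> \<le> C + D" using C[of k] D[of k] by (simp only: distrib_right add_mono)
    finally show ?thesis .
  qed
  then show "\<exists>C. \<forall>k. norm (a k + b k) * real (Suc k) ^ m \<le> C" by blast
qed

lemma rapid_seq_diff:
  assumes "rapid_seq a" "rapid_seq b"
  shows "rapid_seq (\<lambda>k. a k - b k)"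
proof -
  have "rapid_seq (\<lambda>k. - b k)" using assms(2) by (simp add: rapid_seq_def)
  from rapid_seq_add[OF assms(1) this] show ?thesis by simp
qed

text \<open>The actions on Hermite coefficients of \<open>(x + d/dx)/2\<close> and \<open>(x - d/dx)/2\<close>.\<close>

definition seq_down :: "(nat \<Rightarrow> 'a::real_vector) \<Rightarrow> nat \<Rightarrow> 'a" where
  "seq_down a k = sqrt (real (Suc k) / 2) *\<^sub>R a (Suc k)"

definition seq_up :: "(nat \<Rightarrow> 'a::real_vector) \<Rightarrow> nat \<Rightarrow> 'a" where
  "seq_up a k = sqrt (real k / 2) *\<^sub>R a (k - 1)"

lemma sqrt_half_le: "sqrt (real k / 2) \<le> real k"
proof (rule real_le_lsqrt)
  show "real k / 2 \<le> (real k)\<^sup>2"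
    by (cases k) (auto simp: power2_eq_square algebra_simps add_nonneg_nonneg)
qed auto

lemma sqrt_half_le': "\<bar>sqrt (real k / 2)\<bar> \<le> real (Suc k)" "\<bar>sqrt (real (Suc k) / 2)\<bar> \<le> real (Suc k)"
  using sqrt_half_le[of k] sqrt_half_le[of "Suc k"] by simp_all

lemma rapid_seq_down:
  assumes "rapid_seq a"
  shows "rapid_seq (seq_down a)"
proof -
  have "rapid_seq (\<lambda>k. a (Suc k))"
    unfolding rapid_seq_def
  proof
    fix m
    obtain C where C: "\<And>k. norm (a k) * real (Suc k) ^ m \<le> C"
      using assms(1) unfolding rapid_seq_def by blast
    have "norm (a (Suc k)) * real (Suc k) ^ m \<le> C" for k
    proof -
      have "norm (a (Suc k)) * real (Suc k) ^ m \<le> norm (a (Suc k)) * real (Suc (Suc k)) ^ m"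
        by (intro mult_left_mono power_mono) auto
      also have "\<dots> \<le> C" by (rule C)
      finally show ?thesis .
    qed
    then show "\<exists>C. \<forall>k. norm (a (Suc k)) * real (Suc k) ^ m \<le> C" by blast
  qed
  then show ?thesis unfolding seq_down_def[abs_def] by (rule rapid_seq_scale) (rule sqrt_half_le')
qed

lemma rapid_seq_up:
  assumes "rapid_seq a"
  shows "rapid_seq (seq_up a)"
proof -
  have "rapid_seq (\<lambda>k. a (k - 1))"
    unfolding rapid_seq_def
  proof
    fix m
    obtain C where C: "\<And>k. norm (a k) * real (Suc k) ^ m \<le> C"
      using assms(1) unfolding rapid_seq_def by blast
    \<comment> \<open>The shift costs \<open>2 ^ m\<close> because
      \<open>Suc k \<le> 2 * Suc (k - 1)\<close>, also at \<open>k = 0\<close>.\<close>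
    have "norm (a (k - 1)) * real (Suc k) ^ m \<le> 2 ^ m * C" for k
    proof -
      have "norm (a (k - 1)) * real (Suc k) ^ m \<le> norm (a (k - 1)) * (2 * real (Suc (k - 1))) ^ m"
        by (intro mult_left_mono power_mono) auto
      also have "\<dots> = 2 ^ m * (norm (a (k - 1)) * real (Suc (k - 1)) ^ m)"
        by (simp only: power_mult_distrib mult_ac)
      also have "\<dots> \<le> 2 ^ m * C" by (intro mult_left_mono C) auto
      finally show ?thesis .
    qed
    then show "\<exists>C. \<forall>k. norm (a (k - 1)) * real (Suc k) ^ m \<le> C" by blast
  qed
  then show ?thesis unfolding seq_up_def[abs_def] by (rule rapid_seq_scale) (rule sqrt_half_le')
qed

text \<open>Decay of order 3 suffices: one power absorbs \<open>real k + 2\<close>, the other two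
  make the majorant summable. By \<open>herm_bound\<close> it controls the Hermite series uniformly
  in \<open>x\<close>.\<close>

lemma rapid_seq_dominated:
  assumes "rapid_seq a"
  obtains M where "summable M" "\<And>k. (real k + 2) * norm (a k) \<le> M k"
proof -
  obtain C where C: "\<And>k. norm (a k) * real (Suc k) ^ 3 \<le> C"
    using assms(1) unfolding rapid_seq_def by blast
  have "summable (\<lambda>k. inverse (real (Suc k) ^ 2))"
    using inverse_power_summable[of 2, where 'a = real] by (subst summable_Suc_iff) simp
  then have "summable (\<lambda>k. (2 * C) * inverse (real (Suc k) ^ 2))" by (rule summable_mult)
  moreover have "(real k + 2) * norm (a k) \<le> (2 * C) * inverse (real (Suc k) ^ 2)" for k
  proof -
    have "(real k + 2) * norm (a k) * real (Suc k) ^ 2 \<le> (2 * real (Suc k)) * norm (a k) * real (Suc k) ^ 2"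
      by (intro mult_right_mono) auto
    also have "\<dots> = 2 * (norm (a k) * real (Suc k) ^ 3)"
      by (simp only: power2_eq_square power3_eq_cube mult_ac)
    also have "\<dots> \<le> 2 * C" using C[of k] by simp
    finally show ?thesis by (simp add: field_simps del: of_nat_Suc)
  qed
  ultimately show ?thesis by (rule that)
qed

lemma norm_herm_scaleR_le: "norm (herm k x *\<^sub>R a) \<le> (real k + 2) * norm a"
  using herm_bound[of k x] by (auto intro: mult_right_mono)

section \<open>Hermite series with rapidly decreasing coefficients\<close>

definition herm_series :: "(nat \<Rightarrow> 'a::banach) \<Rightarrow> real \<Rightarrow> 'a" where
  "herm_series a x = (\<Sum>k. herm k x *\<^sub>R a k)"

lemma herm_series_sums:
  fixes a :: "nat \<Rightarrow> 'a::banach"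
  assumes "rapid_seq a"
  shows "(\<lambda>k. herm k x *\<^sub>R a k) sums herm_series a x"
proof -
  obtain M where M: "summable M" "\<And>k. (real k + 2) * norm (a k) \<le> M k"
    using rapid_seq_dominated[OF assms] by blast
  have "summable (\<lambda>k. herm k x *\<^sub>R a k)"
    by (rule summable_comparison_test'[OF M(1)]) (rule order_trans[OF norm_herm_scaleR_le M(2)])
  then show ?thesis unfolding herm_series_def by (rule summable_sums)
qed

lemma herm_series_bounded:
  fixes a :: "nat \<Rightarrow> 'a::banach"
  assumes "rapid_seq a"
  shows "\<exists>C. \<forall>x. norm (herm_series a x) \<le> C"
proof -
  obtain M where M: "summable M" "\<And>k. (real k + 2) * norm (a k) \<le> M k"
    using rapid_seq_dominated[OF assms] by blast
  have "norm (herm_series a x) \<le> suminf M" for x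
    unfolding herm_series_def
    by (rule norm_suminf_le[OF _ M(1)]) (rule order_trans[OF norm_herm_scaleR_le M(2)])
  then show ?thesis by blast
qed

text \<open>An index shift that loses nothing, since \<open>seq_up a 0\<close> is zero.\<close>

lemma herm_series_up:
  fixes a :: "nat \<Rightarrow> 'a::banach"
  assumes "rapid_seq a"
  shows "(\<lambda>k. (sqrt (real (Suc k) / 2) * herm (Suc k) x) *\<^sub>R a k) sums herm_series (seq_up a) x"
proof -
  have "(\<lambda>k. herm (Suc k) x *\<^sub>R seq_up a (Suc k)) sums herm_series (seq_up a) x"
    using herm_series_sums[OF rapid_seq_up[OF assms], of x]
    by (subst sums_Suc_iff) (simp add: seq_up_def)
  then show ?thesis by (simp add: seq_up_def mult.commute)
qed

lemma herm_series_down: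
  fixes a :: "nat \<Rightarrow> 'a::banach"
  assumes "rapid_seq a"
  shows "(\<lambda>k. (sqrt (real k / 2) * herm (k - 1) x) *\<^sub>R a k) sums herm_series (seq_down a) x"
proof -
  have "(\<lambda>k. (sqrt (real (Suc k) / 2) * herm (Suc k - 1) x) *\<^sub>R a (Suc k)) sums herm_series (seq_down a) x"
    using herm_series_sums[OF rapid_seq_down[OF assms], of x]
    by (simp add: seq_down_def mult.commute)
  then show ?thesis by (subst (asm) sums_Suc_iff) simp
qed

lemma herm_series_add:
  fixes a :: "nat \<Rightarrow> 'a::banach"
  assumes "rapid_seq a" "rapid_seq b"
  shows "herm_series (\<lambda>k. a k + b k) x = herm_series a x + herm_series b x"
  using sums_add[OF herm_series_sums[OF assms(1), of x] herm_series_sums[OF assms(2), of x]]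
  by (simp add: herm_series_def sums_iff scaleR_add_right)

lemma herm_series_diff:
  fixes a :: "nat \<Rightarrow> 'a::banach"
  assumes "rapid_seq a" "rapid_seq b"
  shows "herm_series (\<lambda>k. a k - b k) x = herm_series a x - herm_series b x"
  using sums_diff[OF herm_series_sums[OF assms(1), of x] herm_series_sums[OF assms(2), of x]]
  by (simp add: herm_series_def sums_iff scaleR_diff_right)

lemma x_herm: "x * herm k x = sqrt (real (Suc k) / 2) * herm (Suc k) x + sqrt (real k / 2) * herm (k - 1) x"
  using herm_rec[of x k] by (simp add: real_sqrt_divide field_simps del: of_nat_Suc)

lemma herm_series_xscale:
  fixes a :: "nat \<Rightarrow> 'a::banach"
  assumes "rapid_seq a"
  shows "x *\<^sub>R herm_series a x = herm_series (\<lambda>k. seq_up a k + seq_down a k) x"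
proof -
  have "(\<lambda>k. x *\<^sub>R (herm k x *\<^sub>R a k)) sums (x *\<^sub>R herm_series a x)"
    by (intro sums_scaleR_right herm_series_sums assms)
  moreover have "(\<lambda>k. (sqrt (real (Suc k) / 2) * herm (Suc k) x) *\<^sub>R a k + (sqrt (real k / 2) * herm (k - 1) x) *\<^sub>R a k)
      sums (herm_series (seq_up a) x + herm_series (seq_down a) x)"
    by (intro sums_add herm_series_up herm_series_down assms)
  ultimately have "x *\<^sub>R herm_series a x = herm_series (seq_up a) x + herm_series (seq_down a) x"
    by (simp only: scaleR_scaleR x_herm scaleR_add_left sums_unique2)
  then show ?thesis by (simp add: herm_series_add rapid_seq_up rapid_seq_down assms)
qed

text \<open>Each factor \<open>x\<close> is absorbed into the coefficients, which remain rapidly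
  decreasing, so boundedness of Hermite series is enough.\<close>

lemma rapid_fun_herm_series:
  fixes a :: "nat \<Rightarrow> 'a::banach"
  assumes "rapid_seq a"
  shows "rapid_fun (herm_series a)"
  unfolding rapid_fun_def
proof
  fix m
  show "\<exists>C. \<forall>x. \<bar>x\<bar> ^ m * norm (herm_series a x) \<le> C"
    using assms
  proof (induction m arbitrary: a)
    case 0
    then show ?case using herm_series_bounded[OF 0] by simp
  next
    case (Suc m)
    let ?b = "\<lambda>k. seq_up a k + seq_down a k"
    have "rapid_seq ?b" by (intro rapid_seq_add rapid_seq_up rapid_seq_down Suc)
    moreover have "\<bar>x\<bar> ^ Suc m * norm (herm_series a x) = \<bar>x\<bar> ^ m * norm (herm_series ?b x)" for x
      unfolding herm_series_xscale[OF Suc.prems, symmetric] by simp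
    ultimately show ?case using Suc.IH[of ?b] by presburger
  qed
qed

text \<open>Termwise differentiation: the ladder relation gives the differentiated terms, and the
  Weierstrass test makes their series converge uniformly.\<close>

lemma has_vector_derivative_herm_series:
  fixes a :: "nat \<Rightarrow> 'a::banach"
  assumes "rapid_seq a"
  shows "(herm_series a has_vector_derivative herm_series (\<lambda>k. seq_down a k - seq_up a k) x) (at x)"
proof -
  define h' where "h' k x = sqrt (real k / 2) * herm (k - 1) x - sqrt (real (Suc k) / 2) * herm (Suc k) x" for k x
  define g' where "g' = herm_series (\<lambda>k. seq_down a k - seq_up a k)"
  have g'_sums: "(\<lambda>k. h' k x *\<^sub>R a k) sums g' x" for x
  proof -
    have "(\<lambda>k. (sqrt (real k / 2) * herm (k - 1) x) *\<^sub>R a k - (sqrt (real (Suc k) / 2) * herm (Suc k) x) *\<^sub>R a k)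
        sums (herm_series (seq_down a) x - herm_series (seq_up a) x)"
      by (intro sums_diff herm_series_up herm_series_down assms)
    then show ?thesis
      by (simp add: h'_def g'_def scaleR_diff_left herm_series_diff rapid_seq_up
          rapid_seq_down assms del: of_nat_Suc)
  qed
  \<comment> \<open>The derivative of \<open>herm k\<close> is bounded only quadratically in
    \<open>k\<close>, so the majorant is taken for \<open>2 * real (Suc k)\<close> times
    \<open>a k\<close>.\<close>
  have "rapid_seq (\<lambda>k. real (Suc k) *\<^sub>R a k)" by (rule rapid_seq_scale[OF assms]) simp
  then have "rapid_seq (\<lambda>k. real (Suc k) *\<^sub>R a k + real (Suc k) *\<^sub>R a k)" using rapid_seq_add by blast
  then obtain M where M: "summable M" "\<And>k. (real k + 2) * norm (real (Suc k) *\<^sub>R a k + real (Suc k) *\<^sub>R a k) \<le> M k"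
    using rapid_seq_dominated by blast
  have bM: "norm (h' k x *\<^sub>R a k) \<le> M k" for k x
  proof -
    have "\<bar>h' k x\<bar> \<le> \<bar>sqrt (real k / 2) * herm (k - 1) x\<bar> + \<bar>sqrt (real (Suc k) / 2) * herm (Suc k) x\<bar>"
      unfolding h'_def by (rule abs_triangle_ineq4)
    also have "\<dots> \<le> real k * (real (k - 1) + 2) + real (Suc k) * (real (Suc k) + 2)"
      unfolding abs_mult by (intro add_mono mult_mono herm_bound sqrt_half_le') (auto simp: sqrt_half_le)
    also have "\<dots> \<le> (real k + 2) * (2 * real (Suc k))"
      by (cases k) (auto simp: algebra_simps)
    finally have "\<bar>h' k x\<bar> * norm (a k) \<le> (real k + 2) * (2 * real (Suc k)) * norm (a k)"
      by (rule mult_right_mono) simp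
    also have "\<dots> = (real k + 2) * norm (real (Suc k) *\<^sub>R a k + real (Suc k) *\<^sub>R a k)"
      by (simp flip: scaleR_2 del: of_nat_Suc)
    also have "\<dots> \<le> M k" by (rule M)
    finally show ?thesis by simp
  qed
  have ul: "uniform_limit UNIV (\<lambda>n x. \<Sum>i<n. h' i x *\<^sub>R a i) g' sequentially"
  proof -
    have "uniform_limit UNIV (\<lambda>n x. \<Sum>i<n. h' i x *\<^sub>R a i) (\<lambda>x. \<Sum>i. h' i x *\<^sub>R a i) sequentially"
      by (rule Weierstrass_m_test[OF bM M(1)])
    then show ?thesis using g'_sums by (simp add: sums_iff)
  qed
  have "\<exists>g. \<forall>x\<in>UNIV. (\<lambda>n. herm n x *\<^sub>R a n) sums g x \<and> (g has_derivative (\<lambda>h. h *\<^sub>R g' x)) (at x within UNIV)"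
  proof (rule has_derivative_series)
    show "((\<lambda>x. herm n x *\<^sub>R a n) has_derivative (\<lambda>h. h *\<^sub>R (h' n x *\<^sub>R a n))) (at x within UNIV)" for n x
      using has_vector_derivative_scaleR[OF DERIV_herm_ladder[of n x] has_vector_derivative_const[of "a n"]]
      by (simp add: has_vector_derivative_def h'_def)
    show "(\<lambda>n. herm n 0 *\<^sub>R a n) sums herm_series a 0" by (rule herm_series_sums[OF assms])
  next
    fix e :: real assume "e > 0"
    with ul have "\<forall>\<^sub>F n in sequentially. \<forall>x\<in>UNIV. dist (\<Sum>i<n. h' i x *\<^sub>R a i) (g' x) < e"
      by (rule uniform_limitD)
    then show "\<forall>\<^sub>F n in sequentially. \<forall>x\<in>UNIV. \<forall>h. norm ((\<Sum>i<n. h *\<^sub>R (h' i x *\<^sub>R a i)) - h *\<^sub>R g' x) \<le> e * norm h"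
    proof eventually_elim
      case (elim n)
      have "norm ((\<Sum>i<n. h *\<^sub>R (h' i x *\<^sub>R a i)) - h *\<^sub>R g' x) \<le> e * norm h" for x h
      proof -
        have "norm ((\<Sum>i<n. h *\<^sub>R (h' i x *\<^sub>R a i)) - h *\<^sub>R g' x) = \<bar>h\<bar> * dist (\<Sum>i<n. h' i x *\<^sub>R a i) (g' x)"
          by (simp only: dist_norm flip: scaleR_sum_right scaleR_diff_right norm_scaleR)
        also have "\<dots> \<le> \<bar>h\<bar> * e" using elim by (intro mult_left_mono order.strict_implies_order[of "dist _ _"]) simp_all
        finally show ?thesis by (simp add: mult.commute)
      qed
      then show ?case by blast
    qed
  qed auto
  then obtain g where g: "\<And>x. (\<lambda>n. herm n x *\<^sub>R a n) sums g x" "\<And>x. (g has_vector_derivative g' x) (at x)"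
    by (auto simp: has_vector_derivative_def)
  have "g = herm_series a" using g(1) herm_series_sums[OF assms] sums_unique2 by blast
  then show ?thesis using g(2) unfolding g'_def by simp
qed

lemma herm_series_schwartz:
  assumes "rapid_seq a"
  shows "herm_series a \<in> schwartz_quat"
proof (rule schwartz_quat_coinduct)
  let ?X = "herm_series ` {a. rapid_seq a}"
  show "herm_series a \<in> ?X" using assms by simp
  fix f assume "f \<in> ?X"
  then obtain b where b: "f = herm_series b" "rapid_seq b" by blast
  show "rapid_fun f" unfolding b by (rule rapid_fun_herm_series[OF b(2)])
  have "rapid_seq (\<lambda>k. seq_down b k - seq_up b k)"
    by (intro rapid_seq_diff rapid_seq_up rapid_seq_down b)
  then show "\<exists>f'\<in>?X. \<forall>x. (f has_vector_derivative f' x) (at x)"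
    using has_vector_derivative_herm_series[OF b(2)] unfolding b by blast
qed

text \<open>After interchanging sum and integral, orthonormality keeps only the term of index
  \<open>k\<close>.\<close>

lemma herm_coeff_herm_series:
  fixes a :: "nat \<Rightarrow> 'a::euclidean_space"
  assumes "rapid_seq a"
  shows "herm_coeff (herm_series a) k = a k"
proof -
  obtain M where M: "summable M" "\<And>k. (real k + 2) * norm (a k) \<le> M k"
    using rapid_seq_dominated[OF assms] by blast
  define f where "f j x = herm k x *\<^sub>R (herm j x *\<^sub>R a j)" for j x
  have i: "integrable lborel (f j)" for j
    unfolding f_def scaleR_scaleR by (intro integrable_scaleR_left integrable_herm_mult)
  have ik: "integrable lborel (\<lambda>x. \<bar>herm k x\<bar>)"
    using rapid_fun_integrable[OF rapid_fun_herm] by (intro integrable_abs) (simp add: continuous_intros)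
  have b: "norm (f j x) \<le> M j * \<bar>herm k x\<bar>" for j x
    using mult_left_mono[OF order_trans[OF norm_herm_scaleR_le M(2)], of "\<bar>herm k x\<bar>" j x]
    by (simp add: f_def abs_mult mult.commute mult.left_commute)
  have "(\<lambda>j. integral\<^sup>L lborel (f j)) sums (\<integral>x. (\<Sum>j. f j x) \<partial>lborel)"
  proof (rule sums_integral[OF i])
    show "AE x in lborel. summable (\<lambda>j. norm (f j x))"
      by (intro AE_I2 summable_comparison_test'[OF summable_mult2[OF M(1)]]) (use b in auto)
    show "summable (\<lambda>j. \<integral>x. norm (f j x) \<partial>lborel)"
    proof (rule summable_comparison_test'[OF summable_mult2[OF M(1)]])
      fix j
      have "(\<integral>x. norm (f j x) \<partial>lborel) \<le> (\<integral>x. M j * \<bar>herm k x\<bar> \<partial>lborel)"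
        by (intro integral_mono integrable_norm i integrable_mult_right ik b)
      then show "norm (\<integral>x. norm (f j x) \<partial>lborel) \<le> M j * (\<integral>x. \<bar>herm k x\<bar> \<partial>lborel)"
        by simp
    qed
  qed
  moreover have "(\<Sum>j. f j x) = herm k x *\<^sub>R herm_series a x" for x
    using sums_scaleR_right[OF herm_series_sums[OF assms], of "herm k x" x] by (simp add: sums_iff f_def)
  moreover have "integral\<^sup>L lborel (f j) = (if j = k then a j else 0)" for j
    unfolding f_def scaleR_scaleR
    by (subst integral_scaleR_left) (auto simp: integrable_herm_mult integral_herm_mult)
  ultimately have "(\<lambda>j. if j = k then a j else 0) sums herm_coeff (herm_series a) k"
    by (simp add: herm_coeff_def)
  moreover have "(\<lambda>j. if j = k then a j else 0) sums a k"
    using sums_If_finite_set[of "{k}" a] by simp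
  ultimately show ?thesis by (rule sums_unique2)
qed

section \<open>Uniqueness of coefficients and the characterisation of the range\<close>

text \<open>Once the lower coefficients vanish, \<open>t ^ n\<close> can be divided out for
  \<open>t \<noteq> 0\<close>; the limit at 0 of the remaining series is \<open>c n\<close>.\<close>

lemma real_powser_sums_zero_imp_coeff_zero:
  fixes c :: "nat \<Rightarrow> real"
  assumes "\<And>t. (\<lambda>k. c k * t ^ k) sums 0"
  shows "c n = 0"
proof (induction n rule: less_induct)
  case (less n)
  have "(\<lambda>k. c (k + n) * t ^ k) sums 0" if "t \<noteq> 0" for t
  proof -
    have "(\<lambda>k. c (k + n) * t ^ (k + n)) sums (0 - (\<Sum>k<n. c k * t ^ k))"
      using assms[of t] by (subst sums_iff_shift)  simp
    then have "(\<lambda>k. c (k + n) * t ^ (k + n)) sums 0" using less by simp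
    from sums_divide[OF this, of "t ^ n"] show ?thesis using that by (simp add: power_add)
  qed
  then have "((\<lambda>_. 0) \<longlongrightarrow> c (0 + n)) (at (0::real))"
    by (intro powser_limit_0_strong[of 1 "\<lambda>k. c (k + n)"]) auto
  then show ?case by (simp add: tendsto_const_iff)
qed

text \<open>Real arguments already determine the coefficients: there the series splits into four
  real power series, one for each component.\<close>

lemma quat_powser_coeff_unique:
  fixes c d :: "nat \<Rightarrow> quat"
  assumes "\<And>q. (\<lambda>k. q ^ k * c k) sums f q" "\<And>q. (\<lambda>k. q ^ k * d k) sums f q"
  shows "c = d"
proof
  fix k
  show "c k = d k"
  proof (rule euclidean_eqI)
    fix b :: quat assume "b \<in> Basis"
    have "(\<lambda>k. inner (c k - d k) b * t ^ k) sums 0" for t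
    proof -
      have "(\<lambda>k. of_real t ^ k * c k - of_real t ^ k * d k) sums (f (of_real t) - f (of_real t))"
        by (intro sums_diff assms)
      then have "(\<lambda>k. t ^ k *\<^sub>R (c k - d k)) sums 0"
        by (simp add: scaleR_conv_of_real right_diff_distrib)
      from bounded_linear.sums[OF bounded_linear_inner_left this, of b]
      show ?thesis by (simp add: mult.commute)
    qed
    then have "inner (c k - d k) b = 0" by (rule real_powser_sums_zero_imp_coeff_zero)
    then show "inner (c k) b = inner (d k) b" by (simp add: inner_diff_left)
  qed
qed

lemma SB_coeff_decay:
  assumes "\<phi> \<in> schwartz_quat"
  shows "bdd_above (range (\<lambda>k. norm (SB_coeff \<phi> k) * real k powr p * sqrt (fact k)))"
proof -
  define m where "m = nat \<lceil>p\<rceil>"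
  obtain C where C: "\<And>k. norm (herm_coeff \<phi> k) * real (Suc k) ^ m \<le> C"
    using rapid_seq_herm_coeff[OF assms] unfolding rapid_seq_def by blast
  have "norm (SB_coeff \<phi> k) * real k powr p * sqrt (fact k) \<le> pi powr (-1/2) * C" for k
  proof -
    \<comment> \<open>At \<open>k = 0\<close> the left side is zero, as
      \<open>0 powr p = 0\<close>.\<close>
    have "real k powr p \<le> real (Suc k) ^ m"
    proof (cases "k = 0")
      case False
      have "real k powr p \<le> real k powr real m"
        using False by (intro powr_mono) (auto simp: m_def real_nat_ceiling_ge)
      also have "\<dots> = real k ^ m" using False by (simp add: powr_realpow)
      also have "\<dots> \<le> real (Suc k) ^ m" by (intro power_mono) auto
      finally show ?thesis .
    qed simp
    then have "norm (herm_coeff \<phi> k) * real k powr p \<le> norm (herm_coeff \<phi> k) * real (Suc k) ^ m"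
      by (rule mult_left_mono) simp
    then have "norm (herm_coeff \<phi> k) * real k powr p \<le> C" using C[of k] by linarith
    then have "pi powr (-1/2) * (norm (herm_coeff \<phi> k) * real k powr p) \<le> pi powr (-1/2) * C"
      by (rule mult_left_mono) simp
    moreover have "norm (SB_coeff \<phi> k) * sqrt (fact k) = pi powr (-1/2) * norm (herm_coeff \<phi> k)"
      by (simp add: SB_coeff_def)
    then have "pi powr (-1/2) * (norm (herm_coeff \<phi> k) * real k powr p)
        = norm (SB_coeff \<phi> k) * real k powr p * sqrt (fact k)"
      by (simp only: mult.assoc[symmetric] flip: \<open>norm (SB_coeff \<phi> k) * sqrt (fact k) = _\<close>)
        (simp only: mult_ac)
    ultimately show ?thesis by linarith
  qed
  then show ?thesis by (auto intro!: bdd_aboveI)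
qed

lemma SB_transform_schwartz_sums:
  "\<phi> \<in> schwartz_quat \<Longrightarrow> (\<lambda>k. q ^ k * SB_coeff \<phi> k) sums SB_transform \<phi> q"
  by (intro SB_transform_sums schwartz_quat_rapid_fun schwartz_quat_continuous)

lemma SF_if_coeff_decay:
  assumes f: "\<And>q. (\<lambda>k. q ^ k * c k) sums f q"
    and c: "\<And>p::real. p > 0 \<Longrightarrow> bdd_above (range (\<lambda>k. norm (c k) * real k powr p * sqrt (fact k)))"
  shows "f \<in> SF"
proof -
  define s where "s k = pi powr (-1/2) / sqrt (fact k)" for k :: nat
  have s: "s k > 0" for k by (simp add: s_def)
  \<comment> \<open>Since \<open>SB_coeff\<close> multiplies Hermite coefficients by
    \<open>s k\<close>, these are the coefficients whose Hermite series is the preimage of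
    \<open>f\<close>.\<close>
  define a where "a k = inverse (s k) *\<^sub>R c k" for k
  have na: "norm (a k) = norm (c k) * sqrt (fact k) / pi powr (-1/2)" for k
    by (simp add: a_def s_def)
  have "rapid_seq a"
    unfolding rapid_seq_def
  proof
    fix m
    \<comment> \<open>The exponent \<open>Suc m\<close> is positive even for \<open>m = 0\<close>,
      as hypothesis \<open>c\<close> demands. Because \<open>0 powr p = 0\<close>, that hypothesis
      does not control \<open>c 0\<close>, so \<open>norm (a 0)\<close> enters the bound
      separately.\<close>
    obtain C where C: "\<And>k. norm (c k) * real k powr real (Suc m) * sqrt (fact k) \<le> C"
      using c[of "real (Suc m)"] by (auto simp: bdd_above_def)
    have "norm (a k) * real (Suc k) ^ m \<le> norm (a 0) + 2 ^ m * (C / pi powr (-1/2))" for k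
    proof (cases "k = 0")
      case True
      have "0 \<le> C" using C[of 0] by simp
      then show ?thesis using True by simp
    next
      case False
      have "real (Suc k) ^ m \<le> (2 * real k) ^ m" using False by (intro power_mono) auto
      also have "\<dots> = 2 ^ m * real k ^ m" by (rule power_mult_distrib)
      also have "\<dots> \<le> 2 ^ m * real k ^ Suc m"
        using False by (intro mult_left_mono power_increasing) auto
      also have "real k ^ Suc m = real k powr real (Suc m)" using False by (subst powr_realpow) auto
      finally have "norm (a k) * real (Suc k) ^ m \<le> norm (a k) * (2 ^ m * real k powr real (Suc m))"
        by (rule mult_left_mono) simp
      also have "\<dots> = 2 ^ m * (norm (c k) * real k powr real (Suc m) * sqrt (fact k) / pi powr (-1/2))"
        unfolding na by (simp only: times_divide_eq_left times_divide_eq_right mult_ac)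
      also have "\<dots> \<le> 2 ^ m * (C / pi powr (-1/2))"
        by (intro mult_left_mono divide_right_mono C) auto
      finally show ?thesis by (simp add: add_increasing)
    qed
    then show "\<exists>C. \<forall>k. norm (a k) * real (Suc k) ^ m \<le> C" by blast
  qed
  then have S: "herm_series a \<in> schwartz_quat" and H: "herm_coeff (herm_series a) = a"
    by (rule herm_series_schwartz) (use \<open>rapid_seq a\<close> herm_coeff_herm_series in blast)
  have "SB_coeff (herm_series a) k = c k" for k
  proof -
    have "SB_coeff (herm_series a) k = s k *\<^sub>R a k" by (simp add: SB_coeff_def H s_def)
    then show ?thesis using s[of k] by (simp add: a_def)
  qed
  then have "SB_transform (herm_series a) = f"
    using SB_transform_schwartz_sums[OF S] f sums_unique2 by (metis (no_types, lifting) ext sums_cong)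
  then show ?thesis unfolding SF_def using S by blast
qed

theorem theorem3p4:
  shows "(\<forall>(f :: quat \<Rightarrow> quat) (c :: nat \<Rightarrow> quat).
            (\<forall>q. (\<lambda>k. q ^ k * c k) sums f q) \<longrightarrow>
            (f \<in> SF \<longleftrightarrow>
              (\<forall>p::real. p > 0 \<longrightarrow>
                bdd_above (range (\<lambda>k. norm (c k) * real k powr p * sqrt (fact k))))))
       \<and> SF = {f. \<exists>c :: nat \<Rightarrow> quat.
            (\<forall>q. (\<lambda>k. q ^ k * c k) sums f q) \<and>
            (\<forall>p::real. p > 0 \<longrightarrow>
                bdd_above (range (\<lambda>k. norm (c k) * real k powr p * sqrt (fact k))))}"
proof (intro conjI allI impI)
  fix f :: "quat \<Rightarrow> quat" and c :: "nat \<Rightarrow> quat"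
  assume f: "\<forall>q. (\<lambda>k. q ^ k * c k) sums f q"
  show "f \<in> SF \<longleftrightarrow>
      (\<forall>p::real. p > 0 \<longrightarrow> bdd_above (range (\<lambda>k. norm (c k) * real k powr p * sqrt (fact k))))"
  proof
    assume "f \<in> SF"
    then obtain \<phi> where \<phi>: "\<phi> \<in> schwartz_quat" "f = SB_transform \<phi>" unfolding SF_def by blast
    \<comment> \<open>The decay is established for the coefficients of the transform; uniqueness
      carries it over to the given \<open>c\<close>.\<close>
    have "c = SB_coeff \<phi>"
      using quat_powser_coeff_unique[of c f "SB_coeff \<phi>"] f SB_transform_schwartz_sums[OF \<phi>(1)] \<phi>(2) by simp
    then show "\<forall>p::real. p > 0 \<longrightarrow> bdd_above (range (\<lambda>k. norm (c k) * real k powr p * sqrt (fact k)))"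
      using SB_coeff_decay[OF \<phi>(1)] by simp
  qed (use f SF_if_coeff_decay in blast)
next
  show "SF = {f. \<exists>c :: nat \<Rightarrow> quat.
            (\<forall>q. (\<lambda>k. q ^ k * c k) sums f q) \<and>
            (\<forall>p::real. p > 0 \<longrightarrow>
                bdd_above (range (\<lambda>k. norm (c k) * real k powr p * sqrt (fact k))))}" (is "_ = ?R")
  proof
    show "SF \<subseteq> ?R"
    proof
      fix f assume "f \<in> SF"
      then obtain \<phi> where \<phi>: "\<phi> \<in> schwartz_quat" "f = SB_transform \<phi>" unfolding SF_def by blast
      show "f \<in> ?R" unfolding \<phi>(2)
        by (intro CollectI exI[of _ "SB_coeff \<phi>"] conjI allI impI SB_transform_schwartz_sums SB_coeff_decay \<phi>(1))
    qed
    show "?R \<subseteq> SF" using SF_if_coeff_decay by blast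
  qed
qed

end
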